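(* Let $\mathscr{D}$ be a dyadic lattice in $\mathbb{R}^N$, let $\alpha=\{\alpha_I\}_{I\in\mathscr{D}}$ with $\alpha_I\in[0,\infty)$ for every $I\in\mathscr{D}$, and let $\mu$ and $\nu$ be Radon measures on $\mathbb{R}^N$. Let $1<p<\infty$ and $1/p+1/p'=1$. The following two statements are equivalent. (i) There is a constant $C_1<\infty$ such that $$\sum_{I\in\mathscr{D}} \left|\int_I f\,d\mu\right|\cdot\left|\int_I g\,d\nu\right|\alpha_I \le C_1\,\|f\|_{L^p(\mu)}\,\|g\|_{L^{p'}(\nu)}\qquad \text{for all } f\in L^p(\mu),\ g\in L^{p'}(\nu).$$ (ii) There is a constant $C_2<\infty$ such that for all $I_0\in\mathscr{D}$ both $$\int_{I_0}\Biggl|\sum_{I\in\mathscr{D}:\,I\subset I_0}\alpha_I\,\mu(I)\,\mathbf{1}_I\Biggr|^p d\nu\le C_2^{p}\,\mu(I_0)$$ and $$\int_{I_0}\Biggl|\sum_{I\in\mathscr{D}:\,I\subset I_0}\alpha_I\,\nu(I)\,\mathbf{1}_I\Biggr|^{p'} d\mu\le C_2^{p'}\,\nu(I_0).$$ Moreover, the best (smallest) constants $C_1$ in (i) and $C_2$ in (ii) satisfy $C_2\le C_1\le C(p)\,C_2$, where $C(p)<\infty$ depends only on $p$.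
   Context: A dyadic lattice $\mathscr{D}=\bigcup_{k\in\mathbb{Z}}\mathscr{D}_k$ in $\mathbb{R}^N$ is a collection of half-open cubes such that, for each $k\in\mathbb{Z}$, $\mathscr{D}_k$ is a partition of $\mathbb{R}^N$ into cubes of side length $2^{k}$, and $\mathscr{D}_{k-1}$ is a refinement of $\mathscr{D}_k$ (each cube of $\mathscr{D}_k$ is the disjoint union of $2^N$ cubes of $\mathscr{D}_{k-1}$). $\mathbf{1}_I$ denotes the indicator function of $I$. Radon measures are nonnegative Borel measures finite on bounded sets. *)

theory Defs
  imports "HOL-Analysis.Analysis" "HOL-Library.Disjoint_Sets"
begin

(* The dimension N has to be quantified inside the statement (the constant C(p) must not depend
   on it), so a point of R^N is a function on {..<N}, extended by undefined. *)

definition RN :: "nat \<Rightarrow> (nat \<Rightarrow> real) set" where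
  "RN N = (\<Pi>\<^sub>E i\<in>{..<N}. UNIV)"

(* As R is second countable, the product sigma-algebra is the Borel sigma-algebra of R^N. *)
definition borel_RN :: "nat \<Rightarrow> (nat \<Rightarrow> real) measure" where
  "borel_RN N = (\<Pi>\<^sub>M i\<in>{..<N}. borel)"

definition half_open_cube :: "nat \<Rightarrow> (nat \<Rightarrow> real) \<Rightarrow> real \<Rightarrow> (nat \<Rightarrow> real) set" where
  "half_open_cube N a l = (\<Pi>\<^sub>E i\<in>{..<N}. {a i ..< a i + l})"

(* D k is the k-th generation; the lattice itself is the union of the range of D.
   Since all cubes of one generation have the same side length, the refinement condition
   forces each cube of D k to be the disjoint union of exactly 2^N cubes of D (k - 1). *)
definition dyadic_lattice :: "nat \<Rightarrow> (int \<Rightarrow> (nat \<Rightarrow> real) set set) \<Rightarrow> bool" where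
  "dyadic_lattice N D \<longleftrightarrow>
     (\<forall>k. partition_on (RN N) (D k) \<and>
          (\<forall>I\<in>D k. \<exists>a. I = half_open_cube N a (2 powi k)) \<and>
          refines (RN N) (D (k - 1)) (D k))"

definition radon_measure :: "nat \<Rightarrow> (nat \<Rightarrow> real) measure \<Rightarrow> bool" where
  "radon_measure N \<mu> \<longleftrightarrow>
     sets \<mu> = sets (borel_RN N) \<and>
     (\<forall>B\<in>sets \<mu>. (\<exists>r. \<forall>x\<in>B. L2_set x {..<N} \<le> r) \<longrightarrow> emeasure \<mu> B < \<infinity>)"

definition in_Lp :: "real \<Rightarrow> 'a measure \<Rightarrow> ('a \<Rightarrow> real) \<Rightarrow> bool" where
  "in_Lp p \<mu> f \<longleftrightarrow> f \<in> borel_measurable \<mu> \<and> integrable \<mu> (\<lambda>x. \<bar>f x\<bar> powr p)"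

definition Lp_norm :: "real \<Rightarrow> 'a measure \<Rightarrow> ('a \<Rightarrow> real) \<Rightarrow> real" where
  "Lp_norm p \<mu> f = (LINT x|\<mu>. \<bar>f x\<bar> powr p) powr (1 / p)"

(* meant for p > 0 only, where infinity to the power p is infinity *)
definition ennreal_powr :: "ennreal \<Rightarrow> real \<Rightarrow> ennreal" where
  "ennreal_powr x p = (if x = \<infinity> then \<infinity> else ennreal (enn2real x powr p))"

(* The sum is taken in [0, infinity], so it converges unconditionally and the inequality
   includes its finiteness. *)
definition bilinear_bound ::
  "'a set set \<Rightarrow> ('a set \<Rightarrow> real) \<Rightarrow> 'a measure \<Rightarrow> 'a measure \<Rightarrow> real \<Rightarrow> real \<Rightarrow> real \<Rightarrow> bool" where
  "bilinear_bound \<D> \<alpha> \<mu> \<nu> p p' C \<longleftrightarrow> 0 \<le> C \<and>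
     (\<forall>f g. in_Lp p \<mu> f \<longrightarrow> in_Lp p' \<nu> g \<longrightarrow>
        (\<Sum>\<^sub>\<infinity>I\<in>\<D>. ennreal (\<bar>LINT x:I|\<mu>. f x\<bar> * \<bar>LINT x:I|\<nu>. g x\<bar> * \<alpha> I))
          \<le> ennreal (C * Lp_norm p \<mu> f * Lp_norm p' \<nu> g))"

(* localised sum over the cubes I contained in I0, as a function with values in [0, infinity] *)
definition local_sum ::
  "'a set set \<Rightarrow> ('a set \<Rightarrow> real) \<Rightarrow> 'a measure \<Rightarrow> 'a set \<Rightarrow> 'a \<Rightarrow> ennreal" where
  "local_sum \<D> \<alpha> \<mu> I0 x =
     (\<Sum>\<^sub>\<infinity>I\<in>{I\<in>\<D>. I \<subseteq> I0}. ennreal (\<alpha> I) * emeasure \<mu> I * indicator I x)"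

definition testing_bound ::
  "'a set set \<Rightarrow> ('a set \<Rightarrow> real) \<Rightarrow> 'a measure \<Rightarrow> 'a measure \<Rightarrow> real \<Rightarrow> real \<Rightarrow> real \<Rightarrow> bool" where
  "testing_bound \<D> \<alpha> \<mu> \<nu> p p' C \<longleftrightarrow> 0 \<le> C \<and>
     (\<forall>I0\<in>\<D>.
        (\<integral>\<^sup>+x\<in>I0. ennreal_powr (local_sum \<D> \<alpha> \<mu> I0 x) p \<partial>\<nu>) \<le> ennreal (C powr p) * emeasure \<mu> I0 \<and>
        (\<integral>\<^sup>+x\<in>I0. ennreal_powr (local_sum \<D> \<alpha> \<nu> I0 x) p' \<partial>\<mu>) \<le> ennreal (C powr p') * emeasure \<nu> I0)"

definition best_constant :: "(real \<Rightarrow> bool) \<Rightarrow> real \<Rightarrow> bool" where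
  "best_constant P C \<longleftrightarrow> P C \<and> (\<forall>C'. P C' \<longrightarrow> C \<le> C')"

end

theory Submission
  imports Defs
begin

text \<open>
  From the bilinear bound to testing: take \<open>f = 1\<^sub>J\<close> and let \<open>g\<close> be the dual extremiser of the local sum.

  From testing to the bilinear bound (after Treil): for a finite family of cubes and nonnegative \<open>f\<close>, \<open>g\<close>, write
  \<open>a\<^sub>I\<close>, \<open>b\<^sub>I\<close> for the averages of \<open>f\<close>, \<open>g\<close> with respect to \<open>\<mu>\<close>, \<open>\<nu>\<close>. By symmetry only the cubes with
  \<open>b\<^sub>I\<^sup>q \<nu>(I) \<le> a\<^sub>I\<^sup>p \<mu>(I)\<close> matter. Choose stopping cubes along which \<open>a\<close> increases geometrically, and group
  each cube under the smallest stopping cube \<open>J\<close> containing it; its average is then at most \<open>2 a\<^sub>J\<close>. In the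
  sum over the group of \<open>J\<close> the function \<open>g\<close> may be replaced by its average on every stopping child of \<open>J\<close>,
  and Young's inequality with the testing condition bounds this sum by \<open>C\<close> times
  \<open>a\<^sub>J\<^sup>p \<mu>(J)\<close>, plus the integral of \<open>g\<^sup>q\<close> over \<open>J\<close> minus its children, plus the sum of \<open>b\<^sub>L\<^sup>q \<nu>(L)\<close> over the
  children \<open>L\<close>. The last term is dominated by \<open>a\<^sub>L\<^sup>p \<mu>(L)\<close>, so summing over \<open>J\<close> leaves the Carleson sum of
  \<open>a\<^sub>J\<^sup>p \<mu>(J)\<close> over all stopping cubes, which is at most a constant times the integral of \<open>f\<^sup>p\<close>.
\<close>

section \<open>Stopping cubes\<close>

lemma sum_powr_le_of_doubling:
  fixes a :: "'b \<Rightarrow> real" and l :: "'b \<Rightarrow> int"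
  assumes "finite A" "A \<noteq> {}" "inj_on l A" and s: "0 < s"
    and a: "\<And>J. J \<in> A \<Longrightarrow> 2 powr l J \<le> a J" "\<And>J. J \<in> A \<Longrightarrow> a J \<le> 2 powr (l J + 1)"
  shows "\<exists>J0\<in>A. (\<Sum>J\<in>A. a J powr s) \<le> 2 powr s / (1 - 2 powr - s) * a J0 powr s"
proof -
  define r :: real where "r = 2 powr - s"
  have r: "0 < r" "r < 1" using s by (auto simp: r_def powr_less_one)
  define m where "m = Max (l ` A)"
  have "m \<in> l ` A" unfolding m_def using assms by (intro Max_in) auto
  then obtain J0 where J0: "J0 \<in> A" "l J0 = m" by auto
  have le_m: "l J \<le> m" if "J \<in> A" for J unfolding m_def using that assms by auto
  define n where "n = (\<lambda>J. nat (m - l J))"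
  have inj: "inj_on n A"
    using assms(3) le_m unfolding inj_on_def n_def by (smt (verit) nat_eq_iff2 nat_0_iff)
  have "a J powr s \<le> 2 powr s * 2 powr (m * s) * r ^ n J" if J: "J \<in> A" for J
  proof -
    have "0 \<le> a J" using a(1)[OF J] by (smt (verit) powr_ge_zero)
    then have "a J powr s \<le> (2 powr (l J + 1)) powr s"
      using a(2)[OF J] s by (intro powr_mono2) auto
    also have "\<dots> = 2 powr s * 2 powr (m * s) * 2 powr (- s * n J)"
      using le_m[OF J] by (simp add: n_def powr_powr powr_add[symmetric] algebra_simps)
    also have "2 powr (- s * n J) = r ^ n J"
      unfolding r_def by (simp add: powr_realpow[symmetric] powr_powr)
    finally show ?thesis .
  qed
  then have "(\<Sum>J\<in>A. a J powr s) \<le> (\<Sum>J\<in>A. 2 powr s * 2 powr (m * s) * r ^ n J)"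
    by (rule sum_mono)
  also have "\<dots> = 2 powr s * 2 powr (m * s) * (\<Sum>J\<in>A. r ^ n J)" by (simp add: sum_distrib_left)
  also have "(\<Sum>J\<in>A. r ^ n J) = (\<Sum>k\<in>n ` A. r ^ k)" by (simp add: sum.reindex[OF inj])
  also have "2 powr s * 2 powr (m * s) * (\<Sum>k\<in>n ` A. r ^ k) \<le> 2 powr s * 2 powr (m * s) * (1 / (1 - r))"
  proof (rule mult_left_mono)
    have "(\<Sum>k\<in>n ` A. r ^ k) \<le> (\<Sum>k. r ^ k)"
      using r assms(1) by (intro sum_le_suminf) (auto intro: summable_geometric)
    then show "(\<Sum>k\<in>n ` A. r ^ k) \<le> 1 / (1 - r)"
      using r by (simp add: suminf_geometric)
  qed simp
  also have "\<dots> = 2 powr s / (1 - r) * 2 powr (m * s)" by simp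
  also have "\<dots> \<le> 2 powr s / (1 - r) * a J0 powr s"
  proof (rule mult_left_mono)
    have "(2 powr m) powr s \<le> a J0 powr s" using a(1)[OF J0(1)] J0 s by (intro powr_mono2) auto
    then show "2 powr (m * s) \<le> a J0 powr s" by (simp add: powr_powr)
  qed (use r in auto)
  finally show ?thesis using J0 unfolding r_def by blast
qed

text \<open>
  With \<open>l I = \<lfloor>log 2 a\<^sub>I\<rfloor>\<close> the records are the stopping cubes; defining them by comparison with all
  larger cubes avoids the usual generation-by-generation construction.
\<close>

definition records :: "('a set \<Rightarrow> int) \<Rightarrow> 'a set set \<Rightarrow> 'a set set" where
  "records l F = {J\<in>F. \<forall>I\<in>F. J \<subset> I \<longrightarrow> l I < l J}"

lemma obtain_record:
  assumes "finite F" "I \<in> F" "I \<noteq> {}"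
    and lam: "\<And>I J. I \<in> F \<Longrightarrow> J \<in> F \<Longrightarrow> I \<subseteq> J \<or> J \<subseteq> I \<or> I \<inter> J = {}"
  obtains J where "J \<in> records l F" "I \<subseteq> J" "l I \<le> l J" "\<And>L. L \<in> records l F \<Longrightarrow> I \<subseteq> L \<Longrightarrow> J \<subseteq> L"
proof -
  define A where "A = {J\<in>F. I \<subseteq> J}"
  define m where "m = Max (l ` A)"
  have A: "finite A" "I \<in> A" using assms by (auto simp: A_def)
  have le_m: "l J \<le> m" if "J \<in> A" for J unfolding m_def using that A by auto
  have "m \<in> l ` A" unfolding m_def using A by (intro Max_in) auto
  then have "{J\<in>A. l J = m} \<noteq> {}" "finite {J\<in>A. l J = m}" using A by auto
  then obtain J where J: "J \<in> A" "l J = m" and max: "\<And>L. L \<in> A \<Longrightarrow> l L = m \<Longrightarrow> J \<subseteq> L \<Longrightarrow> J = L"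
    using finite_has_maximal[of "{J\<in>A. l J = m}"] by auto
  show thesis
  proof
    have "l L < l J" if "L \<in> F" "J \<subset> L" for L
      using le_m[of L] max[of L] that J by (force simp: A_def)
    then show "J \<in> records l F" using J by (auto simp: records_def A_def)
    show "I \<subseteq> J" "l I \<le> l J" using J le_m[OF A(2)] by (auto simp: A_def)
    fix L assume L: "L \<in> records l F" "I \<subseteq> L"
    then have "L \<in> A" by (auto simp: A_def records_def)
    moreover have "\<not> L \<subset> J" using L J le_m[OF \<open>L \<in> A\<close>] by (auto simp: A_def records_def)
    ultimately show "J \<subseteq> L" using lam[of J L] J assms(3) by (auto simp: A_def)
  qed
qed

lemma records_inj_on:
  assumes lam: "\<And>I J. I \<in> F \<Longrightarrow> J \<in> F \<Longrightarrow> I \<subseteq> J \<or> J \<subseteq> I \<or> I \<inter> J = {}"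
  shows "inj_on l {J \<in> records l F. x \<in> J}"
proof (rule inj_onI)
  fix I J assume *: "I \<in> {J \<in> records l F. x \<in> J}" "J \<in> {J \<in> records l F. x \<in> J}" "l I = l J"
  then have "I \<subseteq> J \<or> J \<subseteq> I" using lam[of I J] by (auto simp: records_def)
  then show "I = J" using * by (auto simp: records_def psubset_eq)
qed

section \<open>Carleson embedding\<close>

lemma conjugate_exponent:
  fixes p q :: real
  assumes "1 < p" "1 / p + 1 / q = 1"
  shows "1 < q" "(p - 1) * q = p" "(q - 1) * p = q" "1 / q + 1 / p = 1"
proof -
  have q0: "q \<noteq> 0" using assms by auto
  have "p * q = p + q" using assms q0 by (simp add: field_simps)
  then show *: "(p - 1) * q = p" "(q - 1) * p = q" by (simp_all add: algebra_simps)
  show "1 / q + 1 / p = 1" using assms by simp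
  have "(q - 1) * (p - 1) = 1" using \<open>p * q = p + q\<close> by (simp add: algebra_simps)
  then have "0 < (q - 1) * (p - 1)" by simp
  then show "1 < q" using assms(1) by (simp add: zero_less_mult_iff)
qed

lemma young_powr:
  fixes a b p q :: real
  assumes "1 < p" "1 / p + 1 / q = 1" "0 \<le> a" "0 \<le> b"
  shows "a * b \<le> a powr p + b powr q"
proof -
  note q = conjugate_exponent(1)[OF assms(1,2)]
  have "a * b \<le> a powr p / p + b powr q / q"
    using assms q by (intro Youngs_inequality) auto
  also have "\<dots> \<le> a powr p + b powr q"
    using assms q by (intro add_mono) (auto simp: divide_le_eq mult_le_cancel_left1)
  finally show ?thesis .
qed

lemma integrable_restrict:
  fixes f :: "'a \<Rightarrow> real"
  shows "A \<in> sets M \<Longrightarrow> integrable M f \<Longrightarrow> integrable M (\<lambda>x. indicator A x * f x)"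
  using integrable_mult_indicator[of A M f] by simp

lemma integrable_indicator_mult:
  fixes f :: "'a \<Rightarrow> real"
  assumes "1 < p" "f \<in> borel_measurable M" "\<And>x. 0 \<le> f x" "integrable M (\<lambda>x. f x powr p)"
    "I \<in> sets M" "emeasure M I < \<infinity>"
  shows "integrable M (\<lambda>x. indicator I x * f x)"
proof (rule Bochner_Integration.integrable_bound)
  show "integrable M (\<lambda>x. indicator I x + f x powr p)"
    using assms by (intro Bochner_Integration.integrable_add integrable_real_indicator) auto
  show "(\<lambda>x. indicator I x * f x) \<in> borel_measurable M" using assms by measurable
  have "indicator I x * f x \<le> indicator I x + f x powr p" for x
  proof (cases "f x \<le> 1")
    case True then show ?thesis using assms(3)[of x] by (auto simp: indicator_def add_increasing2)
  next
    case False
    then have "f x powr 1 \<le> f x powr p" using assms(1) by (intro powr_mono) auto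
    then show ?thesis using assms(3)[of x] False by (auto simp: indicator_def)
  qed
  then show "AE x in M. norm (indicator I x * f x) \<le> norm (indicator I x + f x powr p)"
    using assms(3) by (auto simp: abs_mult)
qed

lemma carleson_embedding:
  fixes f :: "'a \<Rightarrow> real" and a :: "'a set \<Rightarrow> real"
  assumes pq: "1 < p" "1 / p + 1 / q = 1" and K: "0 < K" and fin: "finite S"
    and S: "\<And>J. J \<in> S \<Longrightarrow> J \<in> sets M" "\<And>J. J \<in> S \<Longrightarrow> emeasure M J < \<infinity>"
    and f: "f \<in> borel_measurable M" "\<And>x. 0 \<le> f x" "integrable M (\<lambda>x. f x powr p)"
    and a: "\<And>J. J \<in> S \<Longrightarrow> 0 \<le> a J" "\<And>J. J \<in> S \<Longrightarrow> a J * measure M J = (\<integral>x. indicator J x * f x \<partial>M)"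
    and sparse: "\<And>x. (\<Sum>J\<in>S. a J powr (p - 1) * indicator J x) powr q
        \<le> K * (\<Sum>J\<in>S. a J powr p * indicator J x)"
  shows "(\<Sum>J\<in>S. a J powr p * measure M J) \<le> 2 * (2 * K) powr (p / q) * (\<integral>x. f x powr p \<partial>M)"
proof -
  define X where "X = (\<Sum>J\<in>S. a J powr p * measure M J)"
  define h where "h = (\<lambda>x. \<Sum>J\<in>S. a J powr (p - 1) * indicator J x)"
  define H where "H = (\<lambda>x. \<Sum>J\<in>S. a J powr p * indicator J x)"
  define t where "t = (2 * K) powr (1 / q)"
  have t: "0 < t" using K by (simp add: t_def)
  have q0: "q \<noteq> 0" using pq by auto
  have int: "integrable M (\<lambda>x. indicator J x * f x)" if "J \<in> S" for J
    using that S f pq by (intro integrable_indicator_mult[of p]) auto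
  have X1: "X = (\<integral>x. f x * h x \<partial>M)"
  proof -
    have "X = (\<Sum>J\<in>S. \<integral>x. a J powr (p - 1) * (indicator J x * f x) \<partial>M)"
      unfolding X_def
    proof (rule sum.cong[OF refl])
      fix J assume J: "J \<in> S"
      have "a J powr p = a J powr (p - 1) * a J"
        using a(1)[OF J] by (cases "a J = 0") (auto simp: powr_diff)
      then show "a J powr p * measure M J = (\<integral>x. a J powr (p - 1) * (indicator J x * f x) \<partial>M)"
        using a(2)[OF J] by simp
    qed
    also have "\<dots> = (\<integral>x. (\<Sum>J\<in>S. a J powr (p - 1) * (indicator J x * f x)) \<partial>M)"
      using int by (intro Bochner_Integration.integral_sum[symmetric]) auto
    also have "\<dots> = (\<integral>x. f x * h x \<partial>M)"
      by (simp add: h_def sum_distrib_left mult_ac)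
    finally show ?thesis .
  qed
  have intH: "integrable M H" unfolding H_def
    using S by (intro Bochner_Integration.integrable_sum integrable_mult_right integrable_real_indicator) auto
  have XH: "X = (\<integral>x. H x \<partial>M)" unfolding H_def X_def
    using S by (subst Bochner_Integration.integral_sum) (auto intro!: sum.cong integrable_real_indicator simp: sets.Int_space_eq2)
  have intfh: "integrable M (\<lambda>x. f x * h x)"
  proof -
    have "f x * h x = (\<Sum>J\<in>S. a J powr (p - 1) * (indicator J x * f x))" for x
      by (simp add: h_def sum_distrib_left mult_ac)
    then show ?thesis using int by simp
  qed
  \<comment> \<open>\<open>t\<close> is chosen so that the second term of Young's inequality integrates to at most \<open>X / 2\<close>.\<close>
  have pt: "f x * h x \<le> t powr p * f x powr p + H x / 2" for x
  proof -
    have h0: "0 \<le> h x" by (auto simp: h_def intro!: sum_nonneg)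
    have "f x * h x = (t * f x) * (h x / t)" using t by simp
    also have "\<dots> \<le> (t * f x) powr p + (h x / t) powr q"
      using pq f(2)[of x] t h0 by (intro young_powr) auto
    also have "(t * f x) powr p = t powr p * f x powr p" using t f(2)[of x] by (simp add: powr_mult)
    also have "(h x / t) powr q = h x powr q / (2 * K)"
      using t h0 K q0 by (simp add: powr_divide t_def powr_powr)
    also have "\<dots> \<le> K * H x / (2 * K)"
      using sparse[of x] K by (intro divide_right_mono) (auto simp: h_def H_def)
    also have "\<dots> = H x / 2" using K by simp
    finally show ?thesis by simp
  qed
  have "X \<le> (\<integral>x. t powr p * f x powr p + H x / 2 \<partial>M)"
    unfolding X1 using intfh intH f(3) pt by (intro integral_mono) auto
  also have "\<dots> = t powr p * (\<integral>x. f x powr p \<partial>M) + X / 2"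
    using intH f(3) by (simp add: XH)
  also have "t powr p = (2 * K) powr (p / q)" by (simp add: t_def powr_powr)
  finally show ?thesis unfolding X_def[symmetric] by simp
qed

section \<open>The bilinear sum over a finite family\<close>

lemma local_estimate:
  fixes g :: "'a \<Rightarrow> real" and b c :: "'a set \<Rightarrow> real"
  assumes pq: "1 < p" "1 / p + 1 / q = 1" and C: "0 < C" and A: "0 \<le> A"
    and fin: "finite E" "finite Ch"
    and J: "J \<in> sets M"
    and E: "\<And>I. I \<in> E \<Longrightarrow> I \<in> sets M" "\<And>I. I \<in> E \<Longrightarrow> emeasure M I < \<infinity>" "\<And>I. I \<in> E \<Longrightarrow> I \<subseteq> J"
    and Ch: "\<And>L. L \<in> Ch \<Longrightarrow> L \<in> sets M" "\<And>L. L \<in> Ch \<Longrightarrow> emeasure M L < \<infinity>"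
      "\<And>L L'. L \<in> Ch \<Longrightarrow> L' \<in> Ch \<Longrightarrow> L \<noteq> L' \<Longrightarrow> L \<inter> L' = {}"
    and EC: "\<And>I L. I \<in> E \<Longrightarrow> L \<in> Ch \<Longrightarrow> I \<inter> L = {} \<or> L \<subseteq> I"
    and g: "g \<in> borel_measurable M" "\<And>x. 0 \<le> g x" "integrable M (\<lambda>x. g x powr q)"
    and b: "\<And>L. L \<in> Ch \<Longrightarrow> 0 \<le> b L" "\<And>L. L \<in> Ch \<Longrightarrow> b L * measure M L = (\<integral>x. indicator L x * g x \<partial>M)"
    and c: "\<And>I. I \<in> E \<Longrightarrow> 0 \<le> c I"
    and test: "integrable M (\<lambda>x. (\<Sum>I\<in>E. c I * indicator I x) powr p)"
      "(\<integral>x. (\<Sum>I\<in>E. c I * indicator I x) powr p \<partial>M) \<le> C powr p * m"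
  shows "A * (\<Sum>I\<in>E. c I * (\<integral>x. indicator I x * g x \<partial>M))
    \<le> C * (A powr p * m + (\<integral>x. indicator (J - \<Union>Ch) x * g x powr q \<partial>M) + (\<Sum>L\<in>Ch. b L powr q * measure M L))"
proof -
  note q = conjugate_exponent(1)[OF pq]
  define F where "F = (\<lambda>x. \<Sum>I\<in>E. c I * indicator I x)"
  define R where "R = J - \<Union>Ch"
  define G where "G = (\<lambda>x. indicator R x * g x + (\<Sum>L\<in>Ch. b L * indicator L x))"
  have R: "R \<in> sets M" unfolding R_def using J Ch(1) fin by auto
  have intg: "integrable M (\<lambda>x. indicator I x * g x)" if "I \<in> sets M" "emeasure M I < \<infinity>" for I
    using that q g by (intro integrable_indicator_mult[of q]) auto
  have intLI: "integrable M (\<lambda>x. indicator L x * (indicator I x * g x))" if "L \<in> sets M" "I \<in> E" for L I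
    using that E by (intro integrable_restrict[OF that(1) intg]) auto
  have intgR: "integrable M (\<lambda>x. indicator I x * (indicator R x * g x))" if "I \<in> E" for I
    using intLI[OF R that] by (simp add: mult_ac)
  have chsum: "(\<Sum>L\<in>Ch. u L * indicator L x) = u L0" if "L0 \<in> Ch" "x \<in> L0" for u :: "'a set \<Rightarrow> real" and x L0
  proof -
    have "(\<Sum>L\<in>Ch. u L * indicator L x) = (\<Sum>L\<in>{L0}. u L * indicator L x)"
      using that fin Ch(3)[of L0] by (intro sum.mono_neutral_right) (auto simp: indicator_def)
    then show ?thesis using that by simp
  qed
  have chsum0: "(\<Sum>L\<in>Ch. u L * indicator L x) = 0" if "x \<notin> \<Union>Ch" for u :: "'a set \<Rightarrow> real" and x
    using that by (intro sum.neutral) (auto simp: indicator_def)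
  have intIL: "integrable M (\<lambda>x. indicator (I \<inter> L) x :: real)" if "I \<in> E" "L \<in> Ch" for I L
    using that E Ch by (intro integrable_real_indicator)
      (auto intro: order.strict_trans1[OF emeasure_mono[OF Int_lower1]])
  have G_int: "integrable M (\<lambda>x. indicator I x * G x)" if "I \<in> E" for I
    unfolding G_def distrib_left sum_distrib_left
    using intgR[OF that] intIL[OF that]
    by (intro Bochner_Integration.integrable_add Bochner_Integration.integrable_sum) (auto simp: mult.left_commute indicator_inter_arith[symmetric])
  \<comment> \<open>Every \<open>L\<close> in \<open>Ch\<close> is either inside or disjoint from \<open>I\<close>, so averaging \<open>g\<close> over \<open>L\<close> does not change its integral over \<open>I\<close>.\<close>
  have G_eq: "(\<integral>x. indicator I x * G x \<partial>M) = (\<integral>x. indicator I x * g x \<partial>M)" if I: "I \<in> E" for I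
  proof -
    have 1: "b L * measure M (I \<inter> L) = (\<integral>x. indicator L x * (indicator I x * g x) \<partial>M)" if L: "L \<in> Ch" for L
    proof -
      consider "I \<inter> L = {}" | "L \<subseteq> I" using EC[OF I L] by blast
      then show ?thesis
      proof cases
        case 1
        then have "(\<lambda>x. indicator L x * (indicator I x * g x)) = (\<lambda>_. 0)"
          by (auto simp: indicator_def fun_eq_iff)
        then show ?thesis using 1 by simp
      next
        case 2
        then have "(\<lambda>x. indicator L x * (indicator I x * g x)) = (\<lambda>x. indicator L x * g x)"
          by (auto simp: indicator_def fun_eq_iff)
        moreover have "I \<inter> L = L" using 2 by auto
        ultimately show ?thesis using b(2)[OF L] by simp
      qed
    qed
    have "(\<integral>x. indicator I x * G x \<partial>M)
        = (\<integral>x. indicator I x * (indicator R x * g x) + (\<Sum>L\<in>Ch. b L * indicator (I \<inter> L) x) \<partial>M)"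
      by (simp add: G_def distrib_left sum_distrib_left indicator_inter_arith mult_ac)
    also have "\<dots> = (\<integral>x. indicator I x * (indicator R x * g x) \<partial>M) + (\<integral>x. (\<Sum>L\<in>Ch. b L * indicator (I \<inter> L) x) \<partial>M)"
      using intgR[OF I] intIL[OF I] by (intro Bochner_Integration.integral_add Bochner_Integration.integrable_sum) auto
    also have "(\<integral>x. (\<Sum>L\<in>Ch. b L * indicator (I \<inter> L) x) \<partial>M) = (\<Sum>L\<in>Ch. b L * measure M (I \<inter> L))"
      using intIL[OF I] E(1)[OF I] Ch(1)
      by (subst Bochner_Integration.integral_sum) (auto intro!: sum.cong simp: sets.Int_space_eq2)
    also have "\<dots> = (\<Sum>L\<in>Ch. \<integral>x. indicator L x * (indicator I x * g x) \<partial>M)" using 1 by simp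
    also have "\<dots> = (\<integral>x. (\<Sum>L\<in>Ch. indicator L x * (indicator I x * g x)) \<partial>M)"
      using intLI[OF Ch(1) I] by (intro Bochner_Integration.integral_sum[symmetric]) auto
    also have "(\<integral>x. indicator I x * (indicator R x * g x) \<partial>M) + \<dots>
        = (\<integral>x. indicator I x * (indicator R x * g x) + (\<Sum>L\<in>Ch. indicator L x * (indicator I x * g x)) \<partial>M)"
      using intLI[OF Ch(1) I] intgR[OF I]
      by (intro Bochner_Integration.integral_add[symmetric] Bochner_Integration.integrable_sum) auto
    also have "\<dots> = (\<integral>x. indicator I x * g x \<partial>M)"
    proof (rule Bochner_Integration.integral_cong[OF refl])
      fix x
      show "indicator I x * (indicator R x * g x) + (\<Sum>L\<in>Ch. indicator L x * (indicator I x * g x)) = indicator I x * g x"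
      proof (cases "x \<in> \<Union>Ch")
        case True
        then obtain L where "L \<in> Ch" "x \<in> L" by auto
        from chsum[OF this, of "\<lambda>_. indicator I x * g x"] True show ?thesis
          by (simp add: R_def mult_ac)
      next
        case False
        from chsum0[OF this, of "\<lambda>_. indicator I x * g x"] False show ?thesis
          using E(3)[OF I] by (auto simp: R_def mult_ac indicator_def)
      qed
    qed
    finally show ?thesis .
  qed
  have G_q: "G x powr q = indicator R x * g x powr q + (\<Sum>L\<in>Ch. b L powr q * indicator L x)" for x
  proof (cases "x \<in> \<Union>Ch")
    case True
    then obtain L where "L \<in> Ch" "x \<in> L" by auto
    from chsum[OF this] True show ?thesis by (simp add: G_def R_def)
  next
    case False
    from chsum0[OF this] show ?thesis by (simp add: G_def indicator_def)
  qed
  have F0: "0 \<le> F x" for x unfolding F_def using c by (auto intro!: sum_nonneg)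
  have G0: "0 \<le> G x" for x unfolding G_def using b g(2) by (auto intro!: sum_nonneg add_nonneg_nonneg)
  have gR: "integrable M (\<lambda>x. indicator R x * g x powr q)"
    using R g(3) by (intro integrable_restrict)
  have chI: "integrable M (\<lambda>x. \<Sum>L\<in>Ch. b L powr q * indicator L x)"
    using Ch by (intro Bochner_Integration.integrable_sum integrable_mult_right integrable_real_indicator) auto
  have intGq: "(\<integral>x. G x powr q \<partial>M) = (\<integral>x. indicator R x * g x powr q \<partial>M) + (\<Sum>L\<in>Ch. b L powr q * measure M L)"
  proof -
    have "(\<integral>x. (\<Sum>L\<in>Ch. b L powr q * indicator L x) \<partial>M) = (\<Sum>L\<in>Ch. b L powr q * measure M L)"
      using Ch by (subst Bochner_Integration.integral_sum) (auto intro!: sum.cong integrable_real_indicator simp: sets.Int_space_eq2)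
    then show ?thesis unfolding G_q using gR chI by simp
  qed
  have GqI: "integrable M (\<lambda>x. G x powr q)" unfolding G_q using gR chI by simp
  have FG: "integrable M (\<lambda>x. F x * G x)" "(\<integral>x. F x * G x \<partial>M) = (\<Sum>I\<in>E. c I * (\<integral>x. indicator I x * g x \<partial>M))"
  proof -
    have eq: "F x * G x = (\<Sum>I\<in>E. c I * (indicator I x * G x))" for x
      by (simp add: F_def sum_distrib_right sum_distrib_left mult_ac)
    show "integrable M (\<lambda>x. F x * G x)" unfolding eq using G_int by (intro Bochner_Integration.integrable_sum) auto
    show "(\<integral>x. F x * G x \<partial>M) = (\<Sum>I\<in>E. c I * (\<integral>x. indicator I x * g x \<partial>M))"
      unfolding eq using G_int G_eq by (subst Bochner_Integration.integral_sum) auto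
  qed
  have pt: "A * (F x * G x) \<le> C * (A powr p / C powr p * F x powr p + G x powr q)" for x
  proof -
    have "A * (F x * G x) = C * ((A * F x / C) * G x)" using C by simp
    also have "\<dots> \<le> C * ((A * F x / C) powr p + G x powr q)"
      using pq C A F0 G0 by (intro mult_left_mono young_powr) auto
    also have "(A * F x / C) powr p = A powr p / C powr p * F x powr p"
      using A C F0 by (simp add: powr_divide powr_mult)
    finally show ?thesis .
  qed
  have Fp: "integrable M (\<lambda>x. F x powr p)" "(\<integral>x. F x powr p \<partial>M) \<le> C powr p * m"
    using test unfolding F_def by auto
  have "A * (\<Sum>I\<in>E. c I * (\<integral>x. indicator I x * g x \<partial>M)) = (\<integral>x. A * (F x * G x) \<partial>M)"
    using FG by simp
  also have "\<dots> \<le> (\<integral>x. C * (A powr p / C powr p * F x powr p + G x powr q) \<partial>M)"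
    using FG(1) Fp GqI pt by (intro integral_mono) auto
  also have "\<dots> = C * (A powr p / C powr p * (\<integral>x. F x powr p \<partial>M) + (\<integral>x. G x powr q \<partial>M))"
    using Fp GqI by simp
  also have "\<dots> \<le> C * (A powr p / C powr p * (C powr p * m) + (\<integral>x. G x powr q \<partial>M))"
    using Fp C by (intro mult_left_mono add_right_mono) auto
  also have "\<dots> = C * (A powr p * m + (\<integral>x. indicator R x * g x powr q \<partial>M) + (\<Sum>L\<in>Ch. b L powr q * measure M L))"
    using C by (simp add: intGq)
  finally show ?thesis unfolding R_def .
qed

lemma integrable_indicator_sum_powr:
  fixes c :: "'a set \<Rightarrow> real"
  assumes "finite E" "0 < p"
    and E: "\<And>I. I \<in> E \<Longrightarrow> I \<in> sets M" "\<And>I. I \<in> E \<Longrightarrow> emeasure M I < \<infinity>"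
    and c: "\<And>I. I \<in> E \<Longrightarrow> 0 \<le> c I"
  shows "integrable M (\<lambda>x. (\<Sum>I\<in>E. c I * indicator I x) powr p)"
proof (rule Bochner_Integration.integrable_bound)
  define B where "B = sum c E"
  show "integrable M (\<lambda>x. \<Sum>I\<in>E. B powr p * indicator I x)"
    using E by (intro Bochner_Integration.integrable_sum integrable_mult_right integrable_real_indicator) auto
  have "(\<lambda>x. \<Sum>I\<in>E. c I * indicator I x) \<in> borel_measurable M"
    using E(1) by (intro borel_measurable_sum borel_measurable_times borel_measurable_indicator) auto
  then show "(\<lambda>x. (\<Sum>I\<in>E. c I * indicator I x) powr p) \<in> borel_measurable M" by simp
  have "(\<Sum>I\<in>E. c I * indicator I x) powr p \<le> (\<Sum>I\<in>E. B powr p * indicator I x)" for x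
  proof (cases "x \<in> \<Union>E")
    case True
    then obtain I where I: "I \<in> E" "x \<in> I" by auto
    have "(\<Sum>I\<in>E. c I * indicator I x) \<le> B" unfolding B_def
      using c by (intro sum_mono) (auto simp: indicator_def)
    then have "(\<Sum>I\<in>E. c I * indicator I x) powr p \<le> B powr p * indicator I x"
      using c I assms(2) by (auto intro!: powr_mono2 sum_nonneg)
    also have "\<dots> \<le> (\<Sum>I\<in>E. B powr p * indicator I x)"
      using I assms(1) by (intro member_le_sum) auto
    finally show ?thesis .
  next
    case False
    then have "(\<Sum>I\<in>E. c I * indicator I x) = 0" by (intro sum.neutral) (auto simp: indicator_def)
    then show ?thesis by (auto intro!: sum_nonneg)
  qed
  then show "AE x in M. norm ((\<Sum>I\<in>E. c I * indicator I x) powr p) \<le> norm (\<Sum>I\<in>E. B powr p * indicator I x)"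
    by (auto intro!: AE_I2 order.trans[OF _ abs_ge_self])
qed

definition sparse_const :: "real \<Rightarrow> real \<Rightarrow> real" where
  "sparse_const p q = (2 powr (p - 1) / (1 - 2 powr - (p - 1))) powr q"

definition carleson_const :: "real \<Rightarrow> real \<Rightarrow> real" where
  "carleson_const p q = 2 * (2 * sparse_const p q) powr (p / q)"

lemma stopping_estimate:
  fixes f g :: "'a \<Rightarrow> real" and a b \<alpha> :: "'a set \<Rightarrow> real"
  assumes pq: "1 < p" "1 / p + 1 / q = 1" and C: "0 < C" and fin: "finite F"
    and lam: "\<And>I J. I \<in> F \<Longrightarrow> J \<in> F \<Longrightarrow> I \<subseteq> J \<or> J \<subseteq> I \<or> I \<inter> J = {}"
    and ne: "\<And>I. I \<in> F \<Longrightarrow> I \<noteq> {}"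
    and F\<mu>: "\<And>I. I \<in> F \<Longrightarrow> I \<in> sets \<mu>" "\<And>I. I \<in> F \<Longrightarrow> emeasure \<mu> I < \<infinity>"
    and F\<nu>: "\<And>I. I \<in> F \<Longrightarrow> I \<in> sets \<nu>" "\<And>I. I \<in> F \<Longrightarrow> emeasure \<nu> I < \<infinity>"
    and \<alpha>: "\<And>I. I \<in> F \<Longrightarrow> 0 \<le> \<alpha> I"
    and f: "f \<in> borel_measurable \<mu>" "\<And>x. 0 \<le> f x" "integrable \<mu> (\<lambda>x. f x powr p)"
    and g: "g \<in> borel_measurable \<nu>" "\<And>x. 0 \<le> g x" "integrable \<nu> (\<lambda>x. g x powr q)"
    and a: "\<And>I. I \<in> F \<Longrightarrow> 0 < a I" "\<And>I. I \<in> F \<Longrightarrow> a I * measure \<mu> I = (\<integral>x. indicator I x * f x \<partial>\<mu>)"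
    and b: "\<And>I. I \<in> F \<Longrightarrow> 0 \<le> b I" "\<And>I. I \<in> F \<Longrightarrow> b I * measure \<nu> I = (\<integral>x. indicator I x * g x \<partial>\<nu>)"
    and dom: "\<And>I. I \<in> F \<Longrightarrow> b I powr q * measure \<nu> I \<le> a I powr p * measure \<mu> I"
    and test: "\<And>E J. J \<in> F \<Longrightarrow> E \<subseteq> {I\<in>F. I \<subseteq> J} \<Longrightarrow>
      (\<integral>x. (\<Sum>I\<in>E. \<alpha> I * measure \<mu> I * indicator I x) powr p \<partial>\<nu>) \<le> C powr p * measure \<mu> J"
  shows "(\<Sum>I\<in>F. \<alpha> I * (\<integral>x. indicator I x * f x \<partial>\<mu>) * (\<integral>x. indicator I x * g x \<partial>\<nu>))
    \<le> 2 * C * (2 * carleson_const p q * (\<integral>x. f x powr p \<partial>\<mu>) + (\<integral>x. g x powr q \<partial>\<nu>))"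
proof -
  note q = conjugate_exponent[OF pq]
  define l where "l = (\<lambda>I. \<lfloor>log 2 (a I)\<rfloor>)"
  have l: "2 powr l I \<le> a I" "a I \<le> 2 powr (l I + 1)" if "I \<in> F" for I
  proof -
    have "2 powr l I \<le> 2 powr log 2 (a I)" unfolding l_def by (intro powr_mono) auto
    moreover have "2 powr log 2 (a I) \<le> 2 powr (l I + 1)" unfolding l_def
      by (intro powr_mono) (use real_of_int_floor_add_one_ge in auto)
    ultimately show "2 powr l I \<le> a I" "a I \<le> 2 powr (l I + 1)" using a(1)[OF that] by auto
  qed
  define S where "S = records l F"
  have SF: "S \<subseteq> F" by (auto simp: S_def records_def)
  have finS: "finite S" using SF fin by (rule finite_subset)
  define E where "E = (\<lambda>J. {I\<in>F. I \<subseteq> J \<and> l I \<le> l J \<and> (\<forall>L\<in>S. I \<subseteq> L \<longrightarrow> J \<subseteq> L)})"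
  define Ch where "Ch = (\<lambda>J. {L\<in>S. L \<subset> J \<and> \<not> (\<exists>L'\<in>S. L \<subset> L' \<and> L' \<subset> J)})"
  define R where "R = (\<lambda>J. J - \<Union>(Ch J))"
  define X where "X = (\<Sum>J\<in>S. a J powr p * measure \<mu> J)"
  have cover: "F = (\<Union>J\<in>S. E J)"
  proof (intro equalityI subsetI)
    fix I assume I: "I \<in> F"
    obtain J where "J \<in> records l F" "I \<subseteq> J" "l I \<le> l J" "\<And>L. L \<in> records l F \<Longrightarrow> I \<subseteq> L \<Longrightarrow> J \<subseteq> L"
      using obtain_record[OF fin I ne[OF I] lam] by blast
    then show "I \<in> (\<Union>J\<in>S. E J)" using I unfolding S_def E_def by blast
  qed (auto simp: E_def)
  have E_disj: "E J \<inter> E J' = {}" if "J \<in> S" "J' \<in> S" "J \<noteq> J'" for J J'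
    using that by (auto simp: E_def)
  have finE: "finite (E J)" "finite (Ch J)" for J using fin finS by (auto simp: E_def Ch_def)
  have between: "\<exists>L\<in>Ch J. I \<subseteq> L" if "I \<in> S" "I \<subset> J" for I J
  proof -
    define B where "B = {L\<in>S. I \<subseteq> L \<and> L \<subset> J}"
    have "finite B" "B \<noteq> {}" using finS that by (auto simp: B_def)
    then obtain L where L: "L \<in> B" and max: "\<forall>L'\<in>B. L \<subseteq> L' \<longrightarrow> L = L'"
      by (metis finite_has_maximal)
    have "L \<in> Ch J" using L max by (auto simp: Ch_def B_def)
    then show ?thesis using L by (auto simp: B_def)
  qed
  have nested: "I \<subseteq> J \<or> J \<subseteq> I" if "I \<in> S" "J \<in> S" "x \<in> I" "x \<in> J" for I J x
    using that SF lam[of I J] by auto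
  have R_sub: "x \<notin> R J" if "I \<in> S" "I \<subset> J" "x \<in> I" for I J x
    using between[OF that(1,2)] that(3) by (auto simp: R_def)
  have R_disj: "R J \<inter> R J' = {}" if J: "J \<in> S" "J' \<in> S" "J \<noteq> J'" for J J'
  proof (rule ccontr)
    assume "R J \<inter> R J' \<noteq> {}"
    then obtain x where x: "x \<in> R J" "x \<in> R J'" by auto
    then have "x \<in> J" "x \<in> J'" by (auto simp: R_def)
    with nested[of J J' x] J have "J \<subset> J' \<or> J' \<subset> J" by auto
    with R_sub J x \<open>x \<in> J\<close> \<open>x \<in> J'\<close> show False by metis
  qed
  have Ch_disj: "L \<inter> L' = {}" if "L \<in> Ch J" "L' \<in> Ch J" "L \<noteq> L'" for J L L'
  proof (rule ccontr)
    assume "L \<inter> L' \<noteq> {}"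
    then obtain x where "x \<in> L" "x \<in> L'" by auto
    moreover have "L \<in> S" "L' \<in> S" using that by (auto simp: Ch_def)
    ultimately have "L \<subset> L' \<or> L' \<subset> L" using nested[of L L' x] that by auto
    then show False using that by (auto simp: Ch_def)
  qed
  have Ch_unique: "Ch J \<inter> Ch J' = {}" if J: "J \<in> S" "J' \<in> S" "J \<noteq> J'" for J J'
  proof (rule ccontr)
    assume "Ch J \<inter> Ch J' \<noteq> {}"
    then obtain L where L: "L \<in> Ch J" "L \<in> Ch J'" by auto
    then have "L \<in> S" by (auto simp: Ch_def)
    then obtain x where "x \<in> L" using ne SF by blast
    moreover have "L \<subset> J" "L \<subset> J'" using L by (auto simp: Ch_def)
    ultimately have "J \<subset> J' \<or> J' \<subset> J" using nested[of J J' x] J by auto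
    then show False using L J by (auto simp: Ch_def)
  qed
  have X_le: "X \<le> carleson_const p q * (\<integral>x. f x powr p \<partial>\<mu>)"
    unfolding X_def carleson_const_def
  proof (rule carleson_embedding[OF pq _ finS])
    have r1: "2 powr - (p - 1) < (1::real)" using pq by (simp add: powr_less_one)
    then show "0 < sparse_const p q" using pq by (simp add: sparse_const_def)
    fix x
    define A where "A = {J\<in>S. x \<in> J}"
    have A: "(\<Sum>J\<in>S. u J * indicator J x) = (\<Sum>J\<in>A. u J)" for u :: "'a set \<Rightarrow> real"
      unfolding A_def using finS by (intro sum.mono_neutral_cong_right) (auto simp: indicator_def)
    have "(\<Sum>J\<in>A. a J powr (p - 1)) powr q \<le> sparse_const p q * (\<Sum>J\<in>A. a J powr p)"
    proof (cases "A = {}")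
      case False
      have AF: "A \<subseteq> F" "finite A" using SF finS by (auto simp: A_def)
      have "\<exists>J0\<in>A. (\<Sum>J\<in>A. a J powr (p - 1)) \<le> 2 powr (p - 1) / (1 - 2 powr - (p - 1)) * a J0 powr (p - 1)"
      proof (rule sum_powr_le_of_doubling)
        show "inj_on l A" unfolding A_def S_def by (rule records_inj_on[OF lam])
      qed (use AF False pq l in auto)
      then obtain J0 where J0: "J0 \<in> A"
        "(\<Sum>J\<in>A. a J powr (p - 1)) \<le> 2 powr (p - 1) / (1 - 2 powr - (p - 1)) * a J0 powr (p - 1)" by blast
      have "(\<Sum>J\<in>A. a J powr (p - 1)) powr q \<le> (2 powr (p - 1) / (1 - 2 powr - (p - 1)) * a J0 powr (p - 1)) powr q"
        using J0(2) q by (intro powr_mono2) (auto intro!: sum_nonneg)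
      also have "\<dots> = sparse_const p q * a J0 powr p"
        unfolding sparse_const_def using r1 by (subst powr_mult) (auto simp: powr_powr q(2))
      also have "\<dots> \<le> sparse_const p q * (\<Sum>J\<in>A. a J powr p)"
        using J0(1) AF by (intro mult_left_mono member_le_sum) (auto simp: sparse_const_def)
      finally show ?thesis .
    qed simp
    then show "(\<Sum>J\<in>S. a J powr (p - 1) * indicator J x) powr q
        \<le> sparse_const p q * (\<Sum>J\<in>S. a J powr p * indicator J x)" unfolding A .
    show "0 \<le> a J" if "J \<in> S" for J using a(1)[of J] SF that by auto
  qed (use SF F\<mu> f a in auto)
  have R_sum: "(\<Sum>J\<in>S. \<integral>x. indicator (R J) x * g x powr q \<partial>\<nu>) \<le> (\<integral>x. g x powr q \<partial>\<nu>)"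
  proof -
    have Rm: "R J \<in> sets \<nu>" if "J \<in> S" for J
      using that SF F\<nu>(1) finE(2)[of J] unfolding R_def Ch_def by (intro sets.Diff sets.finite_Union) auto
    have Ri: "integrable \<nu> (\<lambda>x. indicator (R J) x * g x powr q)" if "J \<in> S" for J
      using Rm[OF that] g(3) by (rule integrable_restrict)
    have "(\<Sum>J\<in>S. \<integral>x. indicator (R J) x * g x powr q \<partial>\<nu>) = (\<integral>x. (\<Sum>J\<in>S. indicator (R J) x * g x powr q) \<partial>\<nu>)"
      using Ri by (intro Bochner_Integration.integral_sum[symmetric])
    also have "\<dots> \<le> (\<integral>x. g x powr q \<partial>\<nu>)"
    proof (rule integral_mono)
      fix x
      have "(\<Sum>J\<in>S. indicator (R J) x * g x powr q) = indicator (\<Union>J\<in>S. R J) x * g x powr q"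
        using finS R_disj by (subst indicator_UN_disjoint) (auto simp: disjoint_family_on_def sum_distrib_right)
      also have "\<dots> \<le> g x powr q" by (auto simp: indicator_def)
      finally show "(\<Sum>J\<in>S. indicator (R J) x * g x powr q) \<le> g x powr q" .
    qed (use Ri g in \<open>auto intro: Bochner_Integration.integrable_sum\<close>)
    finally show ?thesis .
  qed
  have Ch_sum: "(\<Sum>J\<in>S. \<Sum>L\<in>Ch J. b L powr q * measure \<nu> L) \<le> X"
  proof -
    have "(\<Sum>J\<in>S. \<Sum>L\<in>Ch J. b L powr q * measure \<nu> L) = (\<Sum>L\<in>(\<Union>J\<in>S. Ch J). b L powr q * measure \<nu> L)"
      using finS finE Ch_unique by (intro sum.UNION_disjoint[symmetric]) auto
    also have "\<dots> \<le> (\<Sum>L\<in>S. b L powr q * measure \<nu> L)"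
      using finS by (intro sum_mono2) (auto simp: Ch_def)
    also have "\<dots> \<le> X" unfolding X_def using SF dom by (intro sum_mono) auto
    finally show ?thesis .
  qed
  have loc: "(\<Sum>I\<in>E J. \<alpha> I * (\<integral>x. indicator I x * f x \<partial>\<mu>) * (\<integral>x. indicator I x * g x \<partial>\<nu>))
      \<le> 2 * (C * (a J powr p * measure \<mu> J + (\<integral>x. indicator (R J) x * g x powr q \<partial>\<nu>)
                   + (\<Sum>L\<in>Ch J. b L powr q * measure \<nu> L)))" if J: "J \<in> S" for J
  proof -
    have g0: "0 \<le> (\<integral>x. indicator I x * g x \<partial>\<nu>)" for I using g(2) by (intro integral_nonneg_AE) auto
    have EF: "E J \<subseteq> {I\<in>F. I \<subseteq> J}" by (auto simp: E_def)
    have JF: "J \<in> F" using J SF by auto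
    have "\<alpha> I * (\<integral>x. indicator I x * f x \<partial>\<mu>) * (\<integral>x. indicator I x * g x \<partial>\<nu>)
        \<le> 2 * (a J * (\<alpha> I * measure \<mu> I * (\<integral>x. indicator I x * g x \<partial>\<nu>)))" if I: "I \<in> E J" for I
    proof -
      have IF: "I \<in> F" "l I \<le> l J" using I by (auto simp: E_def)
      have "a I \<le> 2 powr (l I + 1)" using l IF by auto
      also have "\<dots> \<le> 2 powr (l J + 1)" using IF by (intro powr_mono) auto
      also have "\<dots> = 2 * 2 powr l J" by (simp add: powr_add)
      also have "\<dots> \<le> 2 * a J" using l(1)[OF JF] by simp
      finally have "a I * (\<alpha> I * measure \<mu> I * (\<integral>x. indicator I x * g x \<partial>\<nu>))
          \<le> 2 * a J * (\<alpha> I * measure \<mu> I * (\<integral>x. indicator I x * g x \<partial>\<nu>))"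
        using \<alpha>[OF IF(1)] g0 by (intro mult_right_mono) auto
      then show ?thesis unfolding a(2)[OF IF(1), symmetric] by (simp add: mult_ac)
    qed
    then have "(\<Sum>I\<in>E J. \<alpha> I * (\<integral>x. indicator I x * f x \<partial>\<mu>) * (\<integral>x. indicator I x * g x \<partial>\<nu>))
        \<le> (\<Sum>I\<in>E J. 2 * (a J * (\<alpha> I * measure \<mu> I * (\<integral>x. indicator I x * g x \<partial>\<nu>))))"
      by (rule sum_mono)
    also have "\<dots> = 2 * (a J * (\<Sum>I\<in>E J. (\<alpha> I * measure \<mu> I) * (\<integral>x. indicator I x * g x \<partial>\<nu>)))"
      by (simp add: sum_distrib_left)
    also have "a J * (\<Sum>I\<in>E J. (\<alpha> I * measure \<mu> I) * (\<integral>x. indicator I x * g x \<partial>\<nu>))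
        \<le> C * (a J powr p * measure \<mu> J + (\<integral>x. indicator (J - \<Union>(Ch J)) x * g x powr q \<partial>\<nu>)
                   + (\<Sum>L\<in>Ch J. b L powr q * measure \<nu> L))"
    proof (rule local_estimate[OF pq C _ finE])
      show "0 \<le> a J" using a(1)[OF JF] by simp
      show "J \<in> sets \<nu>" using F\<nu>(1)[OF JF] .
      show "L \<inter> L' = {}" if "L \<in> Ch J" "L' \<in> Ch J" "L \<noteq> L'" for L L' using Ch_disj[OF that] .
      show "I \<inter> L = {} \<or> L \<subseteq> I" if "I \<in> E J" "L \<in> Ch J" for I L
      proof -
        have "I \<in> F" "L \<in> F" "\<not> I \<subseteq> L" using that SF by (auto simp: E_def Ch_def)
        then show ?thesis using lam[of I L] by auto
      qed
      show "integrable \<nu> (\<lambda>x. (\<Sum>I\<in>E J. \<alpha> I * measure \<mu> I * indicator I x) powr p)"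
        using EF F\<nu> \<alpha> pq by (intro integrable_indicator_sum_powr finE) auto
      show "(\<integral>x. (\<Sum>I\<in>E J. \<alpha> I * measure \<mu> I * indicator I x) powr p \<partial>\<nu>) \<le> C powr p * measure \<mu> J"
        by (rule test[OF JF EF])
    qed (use EF F\<nu> g b \<alpha> SF in \<open>auto simp: Ch_def\<close>)
    finally show ?thesis by (simp add: R_def)
  qed
  have "(\<Sum>I\<in>F. \<alpha> I * (\<integral>x. indicator I x * f x \<partial>\<mu>) * (\<integral>x. indicator I x * g x \<partial>\<nu>))
      = (\<Sum>J\<in>S. \<Sum>I\<in>E J. \<alpha> I * (\<integral>x. indicator I x * f x \<partial>\<mu>) * (\<integral>x. indicator I x * g x \<partial>\<nu>))"
    using cover finS finE E_disj by (simp add: sum.UNION_disjoint)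
  also have "\<dots> \<le> (\<Sum>J\<in>S. 2 * (C * (a J powr p * measure \<mu> J + (\<integral>x. indicator (R J) x * g x powr q \<partial>\<nu>)
                   + (\<Sum>L\<in>Ch J. b L powr q * measure \<nu> L))))"
    using loc by (rule sum_mono)
  also have "\<dots> = 2 * C * (X + (\<Sum>J\<in>S. \<integral>x. indicator (R J) x * g x powr q \<partial>\<nu>)
                   + (\<Sum>J\<in>S. \<Sum>L\<in>Ch J. b L powr q * measure \<nu> L))"
    by (simp add: X_def sum_distrib_left[symmetric] sum.distrib)
  also have "\<dots> \<le> 2 * C * (2 * carleson_const p q * (\<integral>x. f x powr p \<partial>\<mu>) + (\<integral>x. g x powr q \<partial>\<nu>))"
    using X_le R_sum Ch_sum C by (intro mult_left_mono) auto
  finally show ?thesis .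
qed

section \<open>Countable laminar families\<close>

lemma ennreal_powr_mono: "0 \<le> p \<Longrightarrow> x \<le> y \<Longrightarrow> ennreal_powr x p \<le> ennreal_powr y p"
  by (auto simp: ennreal_powr_def top_unique intro!: ennreal_leI powr_mono2 enn2real_mono
      simp: less_top)

lemma ennreal_powr_ennreal: "0 \<le> x \<Longrightarrow> ennreal_powr (ennreal x) p = ennreal (x powr p)"
  by (simp add: ennreal_powr_def)

lemma ennreal_powr_inverse: "0 < p \<Longrightarrow> ennreal_powr (ennreal_powr x (1 / p)) p = x"
  by (auto simp: ennreal_powr_def powr_powr less_top)

lemma finite_sum_le_infsum_ennreal:
  fixes h :: "'a \<Rightarrow> ennreal"
  shows "finite F \<Longrightarrow> F \<subseteq> A \<Longrightarrow> sum h F \<le> infsum h A"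
  by (subst nonneg_infsum_complete) (auto intro: SUP_upper)

lemma infsum_ennreal_le:
  fixes h :: "'a \<Rightarrow> ennreal"
  assumes "\<And>F. finite F \<Longrightarrow> F \<subseteq> A \<Longrightarrow> sum h F \<le> B"
  shows "infsum h A \<le> B"
  using assms by (subst nonneg_infsum_complete) (auto intro: SUP_least)

lemma infsum_le_SUP_enumeration:
  fixes h :: "'a \<Rightarrow> ennreal"
  assumes "range e = A"
  shows "infsum h A \<le> (SUP n. sum h (e ` {..n::nat}))"
proof (rule infsum_ennreal_le)
  fix F assume "finite F" "F \<subseteq> A"
  then obtain N where N: "finite N" "F = e ` N" using assms by (metis finite_subset_image)
  obtain n where "N \<subseteq> {..n}" using N(1) finite_nat_set_iff_bounded_le by (metis atMost_iff subsetI)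
  then have "F \<subseteq> e ` {..n}" using N by auto
  then have "sum h F \<le> sum h (e ` {..n})" by (intro sum_mono2) auto
  also have "\<dots> \<le> (SUP n. sum h (e ` {..n}))" by (rule SUP_upper) simp
  finally show "sum h F \<le> (SUP n. sum h (e ` {..n}))" .
qed

lemma best_constant_exists:
  assumes "closed {C. P C}" "P C0" "\<And>C. P C \<Longrightarrow> 0 \<le> C"
  shows "\<exists>C. best_constant P C"
proof
  have bdd: "bdd_below {C. P C}" using assms(3) by (intro bdd_belowI[of _ 0]) auto
  have "Inf {C. P C} \<in> {C. P C}"
    by (rule closed_contains_Inf) (use assms bdd in auto)
  moreover have "Inf {C. P C} \<le> C'" if "P C'" for C'
    using that bdd by (intro cInf_lower) auto
  ultimately show "best_constant P (Inf {C. P C})" by (simp add: best_constant_def)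
qed

lemma bilinear_bound_swap: "bilinear_bound D \<alpha> \<mu> \<nu> p q C \<Longrightarrow> bilinear_bound D \<alpha> \<nu> \<mu> q p C"
  unfolding bilinear_bound_def by (auto simp: mult_ac)

lemma testing_bound_swap: "testing_bound D \<alpha> \<mu> \<nu> p q C \<Longrightarrow> testing_bound D \<alpha> \<nu> \<mu> q p C"
  unfolding testing_bound_def by auto

lemma closed_bilinear_bound: "closed {C. bilinear_bound D \<alpha> \<mu> \<nu> p q C}"
  unfolding closed_sequential_limits
proof (intro allI impI, elim conjE)
  fix X :: "nat \<Rightarrow> real" and C
  assume X: "\<forall>n. X n \<in> {C. bilinear_bound D \<alpha> \<mu> \<nu> p q C}" "X \<longlonglongrightarrow> C"
  have "0 \<le> C" using X by (intro LIMSEQ_le_const[OF X(2)]) (auto simp: bilinear_bound_def)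
  moreover have "(\<Sum>\<^sub>\<infinity>I\<in>D. ennreal (\<bar>LINT x:I|\<mu>. f x\<bar> * \<bar>LINT x:I|\<nu>. g x\<bar> * \<alpha> I))
      \<le> ennreal (C * Lp_norm p \<mu> f * Lp_norm q \<nu> g)" if "in_Lp p \<mu> f" "in_Lp q \<nu> g" for f g
  proof (rule LIMSEQ_le_const)
    show "(\<lambda>n. ennreal (X n * Lp_norm p \<mu> f * Lp_norm q \<nu> g)) \<longlonglongrightarrow> ennreal (C * Lp_norm p \<mu> f * Lp_norm q \<nu> g)"
      using X(2) by (intro tendsto_intros)
  qed (use X that in \<open>auto simp: bilinear_bound_def\<close>)
  ultimately show "C \<in> {C. bilinear_bound D \<alpha> \<mu> \<nu> p q C}" by (simp add: bilinear_bound_def)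
qed

locale laminar_pair =
  fixes D :: "'a set set" and \<alpha> :: "'a set \<Rightarrow> real" and \<mu> \<nu> :: "'a measure" and p q :: real
  assumes p: "1 < p" and pq: "1 / p + 1 / q = 1"
    and countable: "countable D" and sets_eq: "sets \<mu> = sets \<nu>"
    and D_sets: "I \<in> D \<Longrightarrow> I \<in> sets \<mu>"
    and D_nonempty: "I \<in> D \<Longrightarrow> I \<noteq> {}"
    and finite_\<mu>: "I \<in> D \<Longrightarrow> emeasure \<mu> I < \<infinity>"
    and finite_\<nu>: "I \<in> D \<Longrightarrow> emeasure \<nu> I < \<infinity>"
    and laminar: "I \<in> D \<Longrightarrow> J \<in> D \<Longrightarrow> I \<subseteq> J \<or> J \<subseteq> I \<or> I \<inter> J = {}"
    and \<alpha>_nonneg: "I \<in> D \<Longrightarrow> 0 \<le> \<alpha> I"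
begin

lemma swap: "laminar_pair D \<alpha> \<nu> \<mu> q p"
  using p pq conjugate_exponent[OF p pq] countable sets_eq D_sets D_nonempty finite_\<mu> finite_\<nu> laminar \<alpha>_nonneg
  unfolding laminar_pair_def by auto

lemma q: "1 < q" using conjugate_exponent[OF p pq] by simp

lemma D_sets_\<nu>: "I \<in> D \<Longrightarrow> I \<in> sets \<nu>" using D_sets sets_eq by auto

lemma emeasure_eq: "I \<in> D \<Longrightarrow> emeasure \<mu> I = ennreal (measure \<mu> I)"
  using finite_\<mu> by (simp add: emeasure_eq_ennreal_measure less_top)

lemma sum_ennreal_eq:
  "E \<subseteq> D \<Longrightarrow> (\<Sum>I\<in>E. ennreal (\<alpha> I) * emeasure \<mu> I * indicator I x)
    = ennreal (\<Sum>I\<in>E. \<alpha> I * measure \<mu> I * indicator I x)"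
  using \<alpha>_nonneg
  by (subst sum_ennreal[symmetric])
     (auto intro!: sum.cong simp: emeasure_eq ennreal_mult indicator_def subset_eq)

lemma sum_powr_integrable:
  assumes "finite E" "E \<subseteq> D" "0 < r"
  shows "integrable \<nu> (\<lambda>x. (\<Sum>I\<in>E. \<alpha> I * measure \<mu> I * indicator I x) powr r)"
  using assms D_sets_\<nu> finite_\<nu> \<alpha>_nonneg by (intro integrable_indicator_sum_powr) auto

lemma test_finite:
  assumes test: "testing_bound D \<alpha> \<mu> \<nu> p q C" and J: "J \<in> D" and E: "finite E" "E \<subseteq> {I\<in>D. I \<subseteq> J}"
  shows "(\<integral>x. (\<Sum>I\<in>E. \<alpha> I * measure \<mu> I * indicator I x) powr p \<partial>\<nu>) \<le> C powr p * measure \<mu> J"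
proof -
  let ?\<phi> = "\<lambda>x. \<Sum>I\<in>E. \<alpha> I * measure \<mu> I * indicator I x"
  have ED: "E \<subseteq> D" using E by auto
  have \<phi>0: "0 \<le> ?\<phi> x" for x using ED \<alpha>_nonneg by (auto intro!: sum_nonneg)
  have le: "ennreal (?\<phi> x powr p) \<le> ennreal_powr (local_sum D \<alpha> \<mu> J x) p * indicator J x" for x
  proof (cases "x \<in> J")
    case True
    have "ennreal (?\<phi> x) \<le> local_sum D \<alpha> \<mu> J x"
      unfolding local_sum_def sum_ennreal_eq[OF ED, symmetric]
      using E by (intro finite_sum_le_infsum_ennreal)
    then have "ennreal_powr (ennreal (?\<phi> x)) p \<le> ennreal_powr (local_sum D \<alpha> \<mu> J x) p"
      using p by (intro ennreal_powr_mono) auto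
    then show ?thesis using True \<phi>0 by (simp add: ennreal_powr_ennreal)
  next
    case False
    then have "?\<phi> x = 0" using E by (intro sum.neutral) (auto simp: indicator_def)
    then show ?thesis by simp
  qed
  have "ennreal (\<integral>x. ?\<phi> x powr p \<partial>\<nu>) = (\<integral>\<^sup>+x. ennreal (?\<phi> x powr p) \<partial>\<nu>)"
    using E(1) ED p by (intro nn_integral_eq_integral[symmetric] sum_powr_integrable) auto
  also have "\<dots> \<le> (\<integral>\<^sup>+x\<in>J. ennreal_powr (local_sum D \<alpha> \<mu> J x) p \<partial>\<nu>)"
    using le by (intro nn_integral_mono) auto
  also have "\<dots> \<le> ennreal (C powr p) * emeasure \<mu> J"
    using test J by (auto simp: testing_bound_def)
  also have "\<dots> = ennreal (C powr p * measure \<mu> J)" using J by (simp add: emeasure_eq ennreal_mult)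
  finally show ?thesis by (simp add: ennreal_le_iff)
qed

lemma bilinear_le_of_dominated:
  assumes C: "0 < C" and test: "testing_bound D \<alpha> \<mu> \<nu> p q C" and F: "finite F" "F \<subseteq> D"
    and f: "f \<in> borel_measurable \<mu>" "\<And>x. 0 \<le> f x" "integrable \<mu> (\<lambda>x. f x powr p)"
    and g: "g \<in> borel_measurable \<nu>" "\<And>x. 0 \<le> g x" "integrable \<nu> (\<lambda>x. g x powr q)"
    and pos: "\<And>I. I \<in> F \<Longrightarrow> 0 < (\<integral>x. indicator I x * f x \<partial>\<mu>)"
      "\<And>I. I \<in> F \<Longrightarrow> 0 < (\<integral>x. indicator I x * g x \<partial>\<nu>)"
    and dom: "\<And>I. I \<in> F \<Longrightarrow>
      ((\<integral>x. indicator I x * g x \<partial>\<nu>) / measure \<nu> I) powr q * measure \<nu> I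
      \<le> ((\<integral>x. indicator I x * f x \<partial>\<mu>) / measure \<mu> I) powr p * measure \<mu> I"
  shows "(\<Sum>I\<in>F. \<alpha> I * (\<integral>x. indicator I x * f x \<partial>\<mu>) * (\<integral>x. indicator I x * g x \<partial>\<nu>))
    \<le> 2 * C * (2 * carleson_const p q * (\<integral>x. f x powr p \<partial>\<mu>) + (\<integral>x. g x powr q \<partial>\<nu>))"
proof -
  have null: "(\<integral>x. indicator I x * h x \<partial>M) = 0"
    if "emeasure M I < \<infinity>" "measure M I = 0" "I \<in> sets M" for I M and h :: "'a \<Rightarrow> real"
  proof -
    have "emeasure M I = 0" using that by (simp add: emeasure_eq_ennreal_measure less_top)
    then have "AE x in M. x \<notin> I" using that by (intro AE_not_in null_setsI)
    then have "AE x in M. indicator I x * h x = 0" by eventually_elim auto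
    then show ?thesis by (rule integral_eq_zero_AE)
  qed
  have \<mu>pos: "0 < measure \<mu> I" if "I \<in> F" for I
    using null[of \<mu> I f] pos(1)[OF that] that F D_sets finite_\<mu> by (force simp: less_le)
  have \<nu>pos: "0 < measure \<nu> I" if "I \<in> F" for I
    using null[of \<nu> I g] pos(2)[OF that] that F D_sets_\<nu> finite_\<nu> by (force simp: less_le)
  show ?thesis
  proof (rule stopping_estimate[OF p pq C F(1) _ _ _ _ _ _ _ f g])
    show "(\<integral>x. (\<Sum>I\<in>E. \<alpha> I * measure \<mu> I * indicator I x) powr p \<partial>\<nu>) \<le> C powr p * measure \<mu> J"
      if "J \<in> F" "E \<subseteq> {I\<in>F. I \<subseteq> J}" for E J
      using that F by (intro test_finite[OF test]) (auto intro: finite_subset)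
    show "((\<integral>x. indicator I x * g x \<partial>\<nu>) / measure \<nu> I) powr q * measure \<nu> I
      \<le> ((\<integral>x. indicator I x * f x \<partial>\<mu>) / measure \<mu> I) powr p * measure \<mu> I" if "I \<in> F" for I
      by (rule dom[OF that])
    show "I \<subseteq> J \<or> J \<subseteq> I \<or> I \<inter> J = {}" if "I \<in> F" "J \<in> F" for I J
      using that F laminar by auto
  qed (use F D_sets D_sets_\<nu> D_nonempty finite_\<mu> finite_\<nu> \<alpha>_nonneg \<mu>pos \<nu>pos pos in
      \<open>auto intro!: divide_pos_pos less_imp_le[OF divide_pos_pos] simp: less_imp_neq[symmetric] less_top\<close>)
qed

lemma finite_bilinear:
  assumes C: "0 < C" and test: "testing_bound D \<alpha> \<mu> \<nu> p q C" and F: "finite F" "F \<subseteq> D"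
    and f: "f \<in> borel_measurable \<mu>" "\<And>x. 0 \<le> f x" "integrable \<mu> (\<lambda>x. f x powr p)"
      "(\<integral>x. f x powr p \<partial>\<mu>) \<le> 1"
    and g: "g \<in> borel_measurable \<nu>" "\<And>x. 0 \<le> g x" "integrable \<nu> (\<lambda>x. g x powr q)"
      "(\<integral>x. g x powr q \<partial>\<nu>) \<le> 1"
  shows "(\<Sum>I\<in>F. \<alpha> I * (\<integral>x. indicator I x * f x \<partial>\<mu>) * (\<integral>x. indicator I x * g x \<partial>\<nu>))
    \<le> 4 * (carleson_const p q + carleson_const q p + 1) * C"
proof -
  define u where "u = (\<lambda>I. \<integral>x. indicator I x * f x \<partial>\<mu>)"
  define v where "v = (\<lambda>I. \<integral>x. indicator I x * g x \<partial>\<nu>)"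
  define F' where "F' = {I\<in>F. 0 < u I \<and> 0 < v I}"
  define dom where "dom = (\<lambda>I. (v I / measure \<nu> I) powr q * measure \<nu> I \<le> (u I / measure \<mu> I) powr p * measure \<mu> I)"
  interpret sw: laminar_pair D \<alpha> \<nu> \<mu> q p by (rule swap)
  have uv: "0 \<le> u I" "0 \<le> v I" for I
    unfolding u_def v_def using f(2) g(2) by (auto intro!: integral_nonneg_AE)
  have cc: "0 \<le> carleson_const r s" for r s by (simp add: carleson_const_def)
  have F'F: "finite F'" "F' \<subseteq> D" using F by (auto simp: F'_def)
  have "(\<Sum>I\<in>F. \<alpha> I * u I * v I) = (\<Sum>I\<in>F'. \<alpha> I * u I * v I)"
    unfolding F'_def using F(1) uv by (intro sum.mono_neutral_right) (auto simp: less_le)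
  also have "\<dots> = (\<Sum>I\<in>{I\<in>F'. dom I}. \<alpha> I * u I * v I) + (\<Sum>I\<in>{I\<in>F'. \<not> dom I}. \<alpha> I * u I * v I)"
    using F'F(1) by (subst sum.union_disjoint[symmetric]) (auto intro!: sum.cong)
  also have "(\<Sum>I\<in>{I\<in>F'. dom I}. \<alpha> I * u I * v I)
      \<le> 2 * C * (2 * carleson_const p q * (\<integral>x. f x powr p \<partial>\<mu>) + (\<integral>x. g x powr q \<partial>\<nu>))"
    unfolding u_def v_def
    by (rule bilinear_le_of_dominated[OF C test _ _ f(1-3) g(1-3)])
      (use F F'F in \<open>auto simp: F'_def dom_def u_def v_def\<close>)
  also have "(\<Sum>I\<in>{I\<in>F'. \<not> dom I}. \<alpha> I * u I * v I) = (\<Sum>I\<in>{I\<in>F'. \<not> dom I}. \<alpha> I * v I * u I)"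
    by (simp add: mult_ac)
  also have "\<dots> \<le> 2 * C * (2 * carleson_const q p * (\<integral>x. g x powr q \<partial>\<nu>) + (\<integral>x. f x powr p \<partial>\<mu>))"
    unfolding u_def v_def
    by (rule sw.bilinear_le_of_dominated[OF C testing_bound_swap[OF test] _ _ g(1-3) f(1-3)])
      (use F F'F in \<open>auto simp: F'_def dom_def u_def v_def\<close>)
  finally have "(\<Sum>I\<in>F. \<alpha> I * u I * v I)
      \<le> 2 * C * (2 * carleson_const p q * (\<integral>x. f x powr p \<partial>\<mu>) + (\<integral>x. g x powr q \<partial>\<nu>))
        + 2 * C * (2 * carleson_const q p * (\<integral>x. g x powr q \<partial>\<nu>) + (\<integral>x. f x powr p \<partial>\<mu>))"
    by simp
  also have "\<dots> \<le> 2 * C * (2 * carleson_const p q * 1 + 1) + 2 * C * (2 * carleson_const q p * 1 + 1)"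
    using f(4) g(4) C cc by (intro add_mono mult_left_mono) auto
  finally show ?thesis unfolding u_def v_def by (simp add: algebra_simps)
qed

lemma bilinear_bound_of_testing_pos:
  assumes C: "0 < C" and test: "testing_bound D \<alpha> \<mu> \<nu> p q C"
  shows "bilinear_bound D \<alpha> \<mu> \<nu> p q (4 * (carleson_const p q + carleson_const q p + 1) * C)"
proof -
  define K where "K = 4 * (carleson_const p q + carleson_const q p + 1) * C"
  have cc: "0 \<le> carleson_const r s" for r s by (simp add: carleson_const_def)
  have K: "0 \<le> K" using cc C by (simp add: K_def)
  have normalize: "(\<lambda>x. \<bar>h x\<bar> / s) \<in> borel_measurable M"
      "integrable M (\<lambda>x. (\<bar>h x\<bar> / s) powr r)" "(\<integral>x. (\<bar>h x\<bar> / s) powr r \<partial>M) \<le> 1"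
    if h: "in_Lp r M h" and s: "Lp_norm r M h < s" and r: "1 < r" for M and h :: "'a \<Rightarrow> real" and r s
  proof -
    have n0: "0 \<le> Lp_norm r M h" by (simp add: Lp_norm_def)
    have s0: "0 < s" using n0 s by linarith
    have eq: "(\<bar>h x\<bar> / s) powr r = \<bar>h x\<bar> powr r / s powr r" for x using s0 by (simp add: powr_divide)
    show "(\<lambda>x. \<bar>h x\<bar> / s) \<in> borel_measurable M" using h by (auto simp: in_Lp_def)
    show "integrable M (\<lambda>x. (\<bar>h x\<bar> / s) powr r)" unfolding eq using h by (auto simp: in_Lp_def)
    have "(\<integral>x. \<bar>h x\<bar> powr r \<partial>M) = Lp_norm r M h powr r"
      using r by (simp add: Lp_norm_def powr_powr)
    also have "\<dots> \<le> s powr r" using n0 s r by (intro powr_mono2) auto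
    finally show "(\<integral>x. (\<bar>h x\<bar> / s) powr r \<partial>M) \<le> 1" unfolding eq using s0 by simp
  qed
  have "(\<Sum>\<^sub>\<infinity>I\<in>D. ennreal (\<bar>LINT x:I|\<mu>. f x\<bar> * \<bar>LINT x:I|\<nu>. g x\<bar> * \<alpha> I))
      \<le> ennreal (K * Lp_norm p \<mu> f * Lp_norm q \<nu> g)" if f: "in_Lp p \<mu> f" and g: "in_Lp q \<nu> g" for f g
  proof (rule infsum_ennreal_le)
    fix F assume F: "finite F" "F \<subseteq> D"
    \<comment> \<open>The norms may vanish, so normalise by slightly larger numbers and let \<open>e\<close> tend to 0.\<close>
    define s where "s = (\<lambda>e. Lp_norm p \<mu> f + e)"
    define t where "t = (\<lambda>e. Lp_norm q \<nu> g + e)"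
    let ?S = "\<Sum>I\<in>F. \<bar>LINT x:I|\<mu>. f x\<bar> * \<bar>LINT x:I|\<nu>. g x\<bar> * \<alpha> I"
    have "?S \<le> K * s e * t e" if e: "0 < e" for e
    proof -
      have st: "0 < s e" "0 < t e" unfolding s_def t_def Lp_norm_def using e by (auto intro: add_nonneg_pos)
      have abs: "\<bar>LINT x:I|M. h x\<bar> \<le> r * (\<integral>x. indicator I x * (\<bar>h x\<bar> / r) \<partial>M)"
        if "0 < r" for I r and M :: "'a measure" and h :: "'a \<Rightarrow> real"
      proof -
        have "\<bar>LINT x:I|M. h x\<bar> \<le> (\<integral>x. indicator I x * \<bar>h x\<bar> \<partial>M)"
          using integral_norm_bound[of M "\<lambda>x. indicator I x *\<^sub>R h x"]
          by (simp add: set_lebesgue_integral_def abs_mult)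
        then show ?thesis using that by simp
      qed
      have "?S \<le> (\<Sum>I\<in>F. (s e * (\<integral>x. indicator I x * (\<bar>f x\<bar> / s e) \<partial>\<mu>))
          * (t e * (\<integral>x. indicator I x * (\<bar>g x\<bar> / t e) \<partial>\<nu>)) * \<alpha> I)"
        using abs st F \<alpha>_nonneg
        by (intro sum_mono mult_right_mono mult_mono) (auto intro!: mult_nonneg_nonneg integral_nonneg_AE simp: less_imp_le)
      also have "\<dots> = s e * t e * (\<Sum>I\<in>F. \<alpha> I * (\<integral>x. indicator I x * (\<bar>f x\<bar> / s e) \<partial>\<mu>)
          * (\<integral>x. indicator I x * (\<bar>g x\<bar> / t e) \<partial>\<nu>))"
        unfolding sum_distrib_left by (intro sum.cong) (auto simp: mult_ac)
      also have "\<dots> \<le> s e * t e * K"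
      proof (rule mult_left_mono)
        have "Lp_norm p \<mu> f < s e" "Lp_norm q \<nu> g < t e" using e by (auto simp: s_def t_def)
        then show "(\<Sum>I\<in>F. \<alpha> I * (\<integral>x. indicator I x * (\<bar>f x\<bar> / s e) \<partial>\<mu>)
          * (\<integral>x. indicator I x * (\<bar>g x\<bar> / t e) \<partial>\<nu>)) \<le> K"
          unfolding K_def using st p q
          by (intro finite_bilinear[OF C test F] normalize[OF f] normalize[OF g]) auto
      qed (use st in auto)
      finally show ?thesis by (simp add: mult_ac)
    qed
    then have ev: "\<forall>\<^sub>F e in at_right 0. ?S \<le> K * s e * t e"
      by (auto intro: eventually_mono[OF eventually_at_right_less])
    have "((\<lambda>e. K * s e * t e) \<longlongrightarrow> K * (Lp_norm p \<mu> f + 0) * (Lp_norm q \<nu> g + 0)) (at_right 0)"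
      unfolding s_def t_def by (intro tendsto_intros)
    from tendsto_lowerbound[OF this ev] have "?S \<le> K * Lp_norm p \<mu> f * Lp_norm q \<nu> g" by simp
    then show "(\<Sum>I\<in>F. ennreal (\<bar>LINT x:I|\<mu>. f x\<bar> * \<bar>LINT x:I|\<nu>. g x\<bar> * \<alpha> I))
        \<le> ennreal (K * Lp_norm p \<mu> f * Lp_norm q \<nu> g)"
      using F \<alpha>_nonneg by (subst sum_ennreal) (auto intro!: ennreal_leI mult_nonneg_nonneg)
  qed
  then show ?thesis using K unfolding K_def[symmetric] bilinear_bound_def by blast
qed

lemma testing_bound_mono:
  assumes "testing_bound D \<alpha> \<mu> \<nu> p q C" "C \<le> C'"
  shows "testing_bound D \<alpha> \<mu> \<nu> p q C'"
proof -
  have "ennreal (C powr r) * m \<le> ennreal (C' powr r) * m" if "1 < r" for r m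
    using assms that by (intro mult_right_mono ennreal_leI powr_mono2) (auto simp: testing_bound_def)
  from this[OF p] this[OF q] show ?thesis
    using assms unfolding testing_bound_def by (meson order.trans)
qed

lemma bilinear_bound_of_testing:
  assumes test: "testing_bound D \<alpha> \<mu> \<nu> p q C"
  shows "bilinear_bound D \<alpha> \<mu> \<nu> p q (4 * (carleson_const p q + carleson_const q p + 1) * C)"
proof -
  define K where "K = 4 * (carleson_const p q + carleson_const q p + 1)"
  have "bilinear_bound D \<alpha> \<mu> \<nu> p q (K * (C + inverse (Suc n)))" for n
  proof -
    have "0 \<le> C" using test by (simp add: testing_bound_def)
    then have "0 < C + inverse (Suc n)" by (intro add_nonneg_pos) auto
    then show ?thesis unfolding K_def
      by (rule bilinear_bound_of_testing_pos) (rule testing_bound_mono[OF test], simp)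
  qed
  then have "\<forall>n. K * (C + inverse (Suc n)) \<in> {C. bilinear_bound D \<alpha> \<mu> \<nu> p q C}" by simp
  moreover have "(\<lambda>n. K * (C + inverse (Suc n))) \<longlonglongrightarrow> K * (C + 0)"
    by (intro tendsto_intros LIMSEQ_inverse_real_of_nat)
  ultimately have "K * (C + 0) \<in> {C. bilinear_bound D \<alpha> \<mu> \<nu> p q C}"
    using closed_sequentially[OF closed_bilinear_bound[of D \<alpha> \<mu> \<nu> p q]] by metis
  then show ?thesis by (simp add: K_def)
qed

lemma closed_testing_bound: "closed {C. testing_bound D \<alpha> \<mu> \<nu> p q C}"
  unfolding closed_sequential_limits
proof (intro allI impI, elim conjE)
  fix X :: "nat \<Rightarrow> real" and C
  assume X: "\<forall>n. X n \<in> {C. testing_bound D \<alpha> \<mu> \<nu> p q C}" "X \<longlonglongrightarrow> C"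
  have X0: "0 \<le> X n" for n using X by (auto simp: testing_bound_def)
  have "0 \<le> C" using X0 by (intro LIMSEQ_le_const[OF X(2)]) auto
  have lim: "Y \<le> ennreal (C powr r) * m"
    if "\<And>n. Y \<le> ennreal (X n powr r) * m" "1 < r" "m < \<infinity>" for Y m r
  proof (rule LIMSEQ_le_const)
    have "(\<lambda>n. X n powr r) \<longlonglongrightarrow> C powr r"
      using X(2) X0 that by (intro tendsto_powr') (auto intro: always_eventually)
    then show "(\<lambda>n. ennreal (X n powr r) * m) \<longlonglongrightarrow> ennreal (C powr r) * m"
      using that by (intro tendsto_mult_ennreal tendsto_ennrealI tendsto_const) auto
  qed (use that in auto)
  show "C \<in> {C. testing_bound D \<alpha> \<mu> \<nu> p q C}"
    using X(1) \<open>0 \<le> C\<close> p q finite_\<mu> finite_\<nu> unfolding testing_bound_def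
    by (auto intro!: lim)
qed

lemma testing_of_bilinear_finite:
  assumes bil: "bilinear_bound D \<alpha> \<mu> \<nu> p q C" and J: "J \<in> D" and E: "finite E" "E \<subseteq> {I\<in>D. I \<subseteq> J}"
  shows "(\<integral>x. (\<Sum>I\<in>E. \<alpha> I * measure \<mu> I * indicator I x) powr p \<partial>\<nu>) \<le> C powr p * measure \<mu> J"
proof -
  define \<phi> where "\<phi> = (\<lambda>x. \<Sum>I\<in>E. \<alpha> I * measure \<mu> I * indicator I x)"
  define Y where "Y = (\<integral>x. \<phi> x powr p \<partial>\<nu>)"
  define g where "g = (\<lambda>x. \<phi> x powr (p - 1))"
  have C: "0 \<le> C" using bil by (simp add: bilinear_bound_def)
  have ED: "E \<subseteq> D" using E by auto
  have \<phi>0: "0 \<le> \<phi> x" for x using ED \<alpha>_nonneg by (auto simp: \<phi>_def intro!: sum_nonneg)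
  have Y0: "0 \<le> Y" by (simp add: Y_def)
  have gq: "\<bar>g x\<bar> powr q = \<phi> x powr p" for x
    using conjugate_exponent(2)[OF p pq] by (simp add: g_def powr_powr)
  have \<phi>g: "\<phi> x * g x = \<phi> x powr p" for x
    using \<phi>0[of x] by (cases "\<phi> x = 0") (auto simp: g_def powr_diff)
  have int\<phi>: "integrable \<nu> (\<lambda>x. \<phi> x powr r)" if "0 < r" for r
    unfolding \<phi>_def using E(1) ED that by (rule sum_powr_integrable)
  have g_int: "integrable \<nu> g" unfolding g_def using int\<phi> p by auto
  have g_Lp: "in_Lp q \<nu> g"
    unfolding in_Lp_def gq using g_int int\<phi> p by auto
  have f_pow: "\<bar>indicator J x :: real\<bar> powr p = indicator J x" for x by (simp add: indicator_def)
  have f_Lp: "in_Lp p \<mu> (indicator J)"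
    unfolding in_Lp_def f_pow using J D_sets finite_\<mu> by (auto intro: integrable_real_indicator)
  have f_norm: "Lp_norm p \<mu> (indicator J) = measure \<mu> J powr (1 / p)"
    unfolding Lp_norm_def f_pow using J D_sets by (simp add: sets.Int_space_eq2)
  have g_norm: "Lp_norm q \<nu> g = Y powr (1 / q)" unfolding Lp_norm_def gq Y_def ..
  have f_set: "(LINT x:I|\<mu>. indicator J x) = measure \<mu> I" if "I \<in> E" for I
  proof -
    have "(\<lambda>x. indicator I x *\<^sub>R indicator J x :: real) = indicator I"
      using that E(2) by (auto simp: indicator_def fun_eq_iff)
    then show ?thesis
      using that ED D_sets by (auto simp: set_lebesgue_integral_def sets.Int_space_eq2)
  qed
  have gI: "integrable \<nu> (\<lambda>x. indicator I x * g x)" if "I \<in> E" for I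
    using that ED D_sets_\<nu> g_int by (intro integrable_restrict) auto
  have "Y = (\<integral>x. (\<Sum>I\<in>E. \<alpha> I * measure \<mu> I * (indicator I x * g x)) \<partial>\<nu>)"
    unfolding Y_def \<phi>g[symmetric] by (simp add: \<phi>_def sum_distrib_right sum_distrib_left mult_ac)
  also have "\<dots> = (\<Sum>I\<in>E. \<alpha> I * measure \<mu> I * (\<integral>x. indicator I x * g x \<partial>\<nu>))"
    using gI by (subst Bochner_Integration.integral_sum) auto
  also have "\<dots> \<le> (\<Sum>I\<in>E. \<bar>LINT x:I|\<mu>. indicator J x\<bar> * \<bar>LINT x:I|\<nu>. g x\<bar> * \<alpha> I)"
  proof (rule sum_mono)
    fix I assume I: "I \<in> E"
    have "(\<alpha> I * measure \<mu> I) * (\<integral>x. indicator I x * g x \<partial>\<nu>) \<le> (\<alpha> I * measure \<mu> I) * \<bar>\<integral>x. indicator I x * g x \<partial>\<nu>\<bar>"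
      using I ED \<alpha>_nonneg by (intro mult_left_mono) auto
    then show "\<alpha> I * measure \<mu> I * (\<integral>x. indicator I x * g x \<partial>\<nu>)
        \<le> \<bar>LINT x:I|\<mu>. indicator J x\<bar> * \<bar>LINT x:I|\<nu>. g x\<bar> * \<alpha> I"
      unfolding f_set[OF I] by (simp add: set_lebesgue_integral_def mult_ac)
  qed
  finally have "ennreal Y \<le> (\<Sum>I\<in>E. ennreal (\<bar>LINT x:I|\<mu>. indicator J x\<bar> * \<bar>LINT x:I|\<nu>. g x\<bar> * \<alpha> I))"
    using ED \<alpha>_nonneg by (subst sum_ennreal) (auto intro!: ennreal_leI)
  also have "\<dots> \<le> (\<Sum>\<^sub>\<infinity>I\<in>D. ennreal (\<bar>LINT x:I|\<mu>. indicator J x\<bar> * \<bar>LINT x:I|\<nu>. g x\<bar> * \<alpha> I))"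
    using E(1) ED by (rule finite_sum_le_infsum_ennreal)
  also have "\<dots> \<le> ennreal (C * measure \<mu> J powr (1 / p) * Y powr (1 / q))"
    using bil[unfolded bilinear_bound_def, THEN conjunct2, rule_format, OF f_Lp g_Lp]
    by (simp only: f_norm g_norm)
  finally have Y_le: "Y \<le> C * measure \<mu> J powr (1 / p) * Y powr (1 / q)"
    using C by (simp add: ennreal_le_iff)
  have "Y \<le> C powr p * measure \<mu> J"
  proof (cases "Y = 0")
    case False
    then have pos: "0 < Y powr (1 / q)" using Y0 by simp
    have "Y powr (1 / p) * Y powr (1 / q) = Y" using pq Y0 False by (simp add: powr_add[symmetric])
    with Y_le have "Y powr (1 / p) \<le> C * measure \<mu> J powr (1 / p)"
      using pos by (metis mult_le_cancel_right not_less_iff_gr_or_eq)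
    then have "(Y powr (1 / p)) powr p \<le> (C * measure \<mu> J powr (1 / p)) powr p"
      using p by (intro powr_mono2) auto
    then show ?thesis using p C Y0 by (simp add: powr_mult powr_powr)
  qed (use C in auto)
  then show ?thesis by (simp add: Y_def \<phi>_def)
qed

lemma testing_of_bilinear:
  assumes bil: "bilinear_bound D \<alpha> \<mu> \<nu> p q C" and J: "J \<in> D"
  shows "(\<integral>\<^sup>+x\<in>J. ennreal_powr (local_sum D \<alpha> \<mu> J x) p \<partial>\<nu>) \<le> ennreal (C powr p) * emeasure \<mu> J"
proof -
  define A where "A = {I\<in>D. I \<subseteq> J}"
  define e where "e = from_nat_into A"
  have "A \<noteq> {}" "countable A" using countable J by (auto simp: A_def)
  then have e: "range e = A" unfolding e_def by (rule range_from_nat_into)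
  define T where "T = (\<lambda>n. e ` {..n::nat})"
  have T: "finite (T n)" "T n \<subseteq> {I\<in>D. I \<subseteq> J}" "T n \<subseteq> D" for n using e by (auto simp: T_def A_def)
  define \<phi> where "\<phi> = (\<lambda>n x. \<Sum>I\<in>T n. \<alpha> I * measure \<mu> I * indicator I x)"
  have \<phi>0: "0 \<le> \<phi> n x" for n x using T(3)[of n] \<alpha>_nonneg by (auto simp: \<phi>_def intro!: sum_nonneg mult_nonneg_nonneg)
  have \<phi>_mono: "\<phi> m x \<le> \<phi> n x" if "m \<le> n" for m n x
    unfolding \<phi>_def using T[of n] \<alpha>_nonneg that by (intro sum_mono2) (auto simp: T_def)
  have le: "ennreal_powr (local_sum D \<alpha> \<mu> J x) p * indicator J x \<le> (SUP n. ennreal (\<phi> n x powr p))" for x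
  proof -
    define B where "B = (SUP n. ennreal (\<phi> n x powr p))"
    have "local_sum D \<alpha> \<mu> J x \<le> (SUP n. \<Sum>I\<in>e ` {..n}. ennreal (\<alpha> I) * emeasure \<mu> I * indicator I x)"
      unfolding local_sum_def by (rule infsum_le_SUP_enumeration) (use e in \<open>simp add: A_def\<close>)
    also have "\<dots> = (SUP n. ennreal (\<phi> n x))"
      using sum_ennreal_eq[OF T(3)] by (simp only: T_def \<phi>_def)
    also have "\<dots> \<le> ennreal_powr B (1 / p)"
    proof (rule SUP_least)
      fix n
      have "ennreal (\<phi> n x) = ennreal_powr (ennreal (\<phi> n x powr p)) (1 / p)"
        using p \<phi>0 by (simp add: ennreal_powr_ennreal powr_powr)
      also have "\<dots> \<le> ennreal_powr B (1 / p)"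
        using p unfolding B_def by (intro ennreal_powr_mono SUP_upper) auto
      finally show "ennreal (\<phi> n x) \<le> ennreal_powr B (1 / p)" .
    qed
    finally have "ennreal_powr (local_sum D \<alpha> \<mu> J x) p \<le> ennreal_powr (ennreal_powr B (1 / p)) p"
      using p by (intro ennreal_powr_mono) auto
    also have "\<dots> = B" using p by (simp add: ennreal_powr_inverse)
    finally show ?thesis unfolding B_def by (auto simp: indicator_def)
  qed
  have int\<phi>: "integrable \<nu> (\<lambda>x. \<phi> n x powr p)" for n
    unfolding \<phi>_def using T p by (intro sum_powr_integrable) auto
  have "(\<integral>\<^sup>+x\<in>J. ennreal_powr (local_sum D \<alpha> \<mu> J x) p \<partial>\<nu>) \<le> (\<integral>\<^sup>+x. (SUP n. ennreal (\<phi> n x powr p)) \<partial>\<nu>)"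
    using le by (intro nn_integral_mono) auto
  also have "\<dots> = (SUP n. \<integral>\<^sup>+x. ennreal (\<phi> n x powr p) \<partial>\<nu>)"
  proof (rule nn_integral_monotone_convergence_SUP)
    show "incseq (\<lambda>n x. ennreal (\<phi> n x powr p))"
      using \<phi>_mono \<phi>0 p by (auto simp: incseq_def le_fun_def intro!: ennreal_leI powr_mono2)
  qed (use int\<phi> in \<open>auto dest: borel_measurable_integrable\<close>)
  also have "\<dots> \<le> ennreal (C powr p) * emeasure \<mu> J"
  proof (rule SUP_least)
    fix n
    have "(\<integral>\<^sup>+x. ennreal (\<phi> n x powr p) \<partial>\<nu>) = ennreal (\<integral>x. \<phi> n x powr p \<partial>\<nu>)"
      using int\<phi> by (intro nn_integral_eq_integral) auto
    also have "\<dots> \<le> ennreal (C powr p * measure \<mu> J)"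
      unfolding \<phi>_def using T by (intro ennreal_leI testing_of_bilinear_finite[OF bil J])
    also have "\<dots> = ennreal (C powr p) * emeasure \<mu> J" using J by (simp add: emeasure_eq ennreal_mult)
    finally show "(\<integral>\<^sup>+x. ennreal (\<phi> n x powr p) \<partial>\<nu>) \<le> ennreal (C powr p) * emeasure \<mu> J" .
  qed
  finally show ?thesis .
qed

lemma testing_bound_of_bilinear:
  assumes bil: "bilinear_bound D \<alpha> \<mu> \<nu> p q C"
  shows "testing_bound D \<alpha> \<mu> \<nu> p q C"
  using bil testing_of_bilinear[OF bil] laminar_pair.testing_of_bilinear[OF swap bilinear_bound_swap[OF bil]]
  by (auto simp: testing_bound_def bilinear_bound_def)

lemma bilinear_iff_testing:
  "(\<exists>C. bilinear_bound D \<alpha> \<mu> \<nu> p q C) \<longleftrightarrow> (\<exists>C. testing_bound D \<alpha> \<mu> \<nu> p q C)"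
  using bilinear_bound_of_testing testing_bound_of_bilinear by blast

lemma best_constants:
  assumes "\<exists>C. bilinear_bound D \<alpha> \<mu> \<nu> p q C"
  shows "\<exists>C1 C2. best_constant (bilinear_bound D \<alpha> \<mu> \<nu> p q) C1 \<and> best_constant (testing_bound D \<alpha> \<mu> \<nu> p q) C2
    \<and> C2 \<le> C1 \<and> C1 \<le> 4 * (carleson_const p q + carleson_const q p + 1) * C2"
proof -
  obtain C where C: "bilinear_bound D \<alpha> \<mu> \<nu> p q C" using assms by blast
  have "0 \<le> C" if "bilinear_bound D \<alpha> \<mu> \<nu> p q C" for C using that by (simp add: bilinear_bound_def)
  from best_constant_exists[OF closed_bilinear_bound C this]
  obtain C1 where C1: "best_constant (bilinear_bound D \<alpha> \<mu> \<nu> p q) C1" by blast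
  have "0 \<le> C" if "testing_bound D \<alpha> \<mu> \<nu> p q C" for C using that by (simp add: testing_bound_def)
  from best_constant_exists[OF closed_testing_bound testing_bound_of_bilinear[OF C] this]
  obtain C2 where C2: "best_constant (testing_bound D \<alpha> \<mu> \<nu> p q) C2" by blast
  from C1 C2 show ?thesis
    using testing_bound_of_bilinear bilinear_bound_of_testing unfolding best_constant_def by blast
qed

end

section \<open>Dyadic lattices\<close>

lemma half_open_cube_sets: "half_open_cube N a l \<in> sets (borel_RN N)"
  unfolding half_open_cube_def borel_RN_def by (intro sets_PiM_I_finite) auto

lemma half_open_cube_bounded: "\<exists>r. \<forall>x\<in>half_open_cube N a l. L2_set x {..<N} \<le> r"
proof (intro exI ballI)
  fix x assume x: "x \<in> half_open_cube N a l"
  have "L2_set x {..<N} \<le> (\<Sum>i<N. \<bar>x i\<bar>)" by (rule L2_set_le_sum_abs)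
  also have "\<dots> \<le> (\<Sum>i<N. \<bar>a i\<bar> + \<bar>l\<bar>)"
    using x by (intro sum_mono) (force simp: half_open_cube_def PiE_def Pi_def)
  finally show "L2_set x {..<N} \<le> (\<Sum>i<N. \<bar>a i\<bar> + \<bar>l\<bar>)" .
qed

lemma half_open_cube_rational:
  assumes "0 < l"
  shows "\<exists>x\<in>(\<Pi>\<^sub>E i\<in>{..<N}. \<rat>). x \<in> half_open_cube N a l"
proof -
  have "\<forall>i. \<exists>r\<in>\<rat>. a i < r \<and> r < a i + l" using assms Rats_dense_in_real by simp
  then obtain r where "\<And>i. r i \<in> \<rat> \<and> a i < r i \<and> r i < a i + l" by metis
  then show ?thesis
    by (intro bexI[of _ "restrict r {..<N}"]) (auto simp: half_open_cube_def less_imp_le)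
qed

context
  fixes N :: nat and D :: "int \<Rightarrow> (nat \<Rightarrow> real) set set"
  assumes dyadic: "dyadic_lattice N D"
begin

lemma dyadic_cube: "I \<in> D k \<Longrightarrow> \<exists>a. I = half_open_cube N a (2 powi k)"
  using dyadic by (auto simp: dyadic_lattice_def)

lemma dyadic_partition: "partition_on (RN N) (D k)"
  using dyadic by (auto simp: dyadic_lattice_def)

lemma countable_dyadic: "countable (\<Union>k. D k)"
proof (rule countable_UN)
  fix k :: int
  have "\<exists>x. x \<in> (\<Pi>\<^sub>E i\<in>{..<N}. \<rat>) \<and> x \<in> I" if I: "I \<in> D k" for I
  proof -
    obtain a where a: "I = half_open_cube N a (2 powi k)" using dyadic_cube[OF I] ..
    have "0 < (2 :: real) powi k" by simp
    from half_open_cube_rational[OF this, of N a] show ?thesis unfolding a by blast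
  qed
  then obtain c where c: "\<And>I. I \<in> D k \<Longrightarrow> c I \<in> (\<Pi>\<^sub>E i\<in>{..<N}. \<rat>) \<and> c I \<in> I" by metis
  have "inj_on c (D k)"
  proof (rule inj_onI)
    fix I J assume "I \<in> D k" "J \<in> D k" "c I = c J"
    then have "I \<in> D k" "J \<in> D k" "I \<inter> J \<noteq> {}" using c[of I] c[of J] by auto
    then show "I = J" using dyadic_partition[of k] by (auto simp: partition_on_def disjoint_def)
  qed
  moreover have "countable (c ` D k)"
  proof (rule countable_subset)
    show "c ` D k \<subseteq> (\<Pi>\<^sub>E i\<in>{..<N}. \<rat>)" using c by blast
    show "countable (\<Pi>\<^sub>E i\<in>{..<N}. \<rat> :: real set)" by (intro countable_PiE countable_rat) simp
  qed
  ultimately show "countable (D k)" by (metis countable_image_inj_on)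
qed simp

lemma dyadic_ancestor: "I \<in> D k \<Longrightarrow> \<exists>J\<in>D (k + int n). I \<subseteq> J"
proof (induction n)
  case (Suc n)
  then obtain J where J: "J \<in> D (k + int n)" "I \<subseteq> J" by auto
  have "refines (RN N) (D (k + int (Suc n) - 1)) (D (k + int (Suc n)))"
    using dyadic unfolding dyadic_lattice_def by blast
  then have "\<exists>Y\<in>D (k + int (Suc n)). J \<subseteq> Y" using J(1) by (simp add: refines_def add.assoc)
  then show ?case using J(2) by blast
qed auto

lemma dyadic_laminar:
  assumes "I \<in> (\<Union>k. D k)" "J \<in> (\<Union>k. D k)"
  shows "I \<subseteq> J \<or> J \<subseteq> I \<or> I \<inter> J = {}"
proof -
  have *: "I \<subseteq> J \<or> I \<inter> J = {}" if km: "I \<in> D k" "J \<in> D m" "k \<le> m" for I J k m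
  proof -
    obtain L where "L \<in> D m" "I \<subseteq> L" using dyadic_ancestor[OF km(1), of "nat (m - k)"] km(3) by auto
    moreover have "L = J \<or> L \<inter> J = {}"
      using \<open>L \<in> D m\<close> km(2) dyadic_partition[of m] by (auto simp: partition_on_def disjoint_def)
    ultimately show ?thesis by blast
  qed
  obtain k m where "I \<in> D k" "J \<in> D m" using assms by auto
  then show ?thesis using *[of I k J m] *[of J m I k] by (cases "k \<le> m") auto
qed

lemma dyadic_laminar_pair:
  assumes "1 < p" "1 / p + 1 / q = 1" "\<forall>I\<in>(\<Union>k. D k). 0 \<le> \<alpha> I"
    and \<mu>: "radon_measure N \<mu>" and \<nu>: "radon_measure N \<nu>"
  shows "laminar_pair (\<Union>k. D k) \<alpha> \<mu> \<nu> p q"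
proof
  have cube: "\<exists>a l. I = half_open_cube N a l" if "I \<in> (\<Union>k. D k)" for I
    using that dyadic_cube by blast
  have sets: "I \<in> sets M" and fin: "emeasure M I < \<infinity>"
    if M: "radon_measure N M" and I: "I \<in> (\<Union>k. D k)" for M I
  proof -
    obtain a l where "I = half_open_cube N a l" using cube[OF I] by blast
    then show "I \<in> sets M" "emeasure M I < \<infinity>"
      using M half_open_cube_sets[of N a l] half_open_cube_bounded[of N a l]
      by (auto simp: radon_measure_def)
  qed
  show "I \<in> (\<Union>k. D k) \<Longrightarrow> I \<in> sets \<mu>" "I \<in> (\<Union>k. D k) \<Longrightarrow> emeasure \<mu> I < \<infinity>" for I
    using sets[OF \<mu>] fin[OF \<mu>] by auto
  show "I \<in> (\<Union>k. D k) \<Longrightarrow> emeasure \<nu> I < \<infinity>" for I using fin[OF \<nu>] by auto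
  show "I \<in> (\<Union>k. D k) \<Longrightarrow> I \<noteq> {}" for I using dyadic_partition by (auto simp: partition_on_def)
  show "sets \<mu> = sets \<nu>" using \<mu> \<nu> by (simp add: radon_measure_def)
qed (use assms countable_dyadic dyadic_laminar in auto)

end

theorem theorem2p1:
  fixes p p' :: real
  assumes "1 < p" and "1 / p + 1 / p' = 1"
  shows "\<exists>K::real. \<forall>(N::nat) (D :: int \<Rightarrow> (nat \<Rightarrow> real) set set)
           (\<alpha> :: (nat \<Rightarrow> real) set \<Rightarrow> real) (\<mu> :: (nat \<Rightarrow> real) measure) (\<nu> :: (nat \<Rightarrow> real) measure).
           1 \<le> N \<longrightarrow> dyadic_lattice N D \<longrightarrow> (\<forall>I\<in>(\<Union>k. D k). 0 \<le> \<alpha> I) \<longrightarrow>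
           radon_measure N \<mu> \<longrightarrow> radon_measure N \<nu> \<longrightarrow>
           ((\<exists>C1. bilinear_bound (\<Union>k. D k) \<alpha> \<mu> \<nu> p p' C1) \<longleftrightarrow>
            (\<exists>C2. testing_bound (\<Union>k. D k) \<alpha> \<mu> \<nu> p p' C2)) \<and>
           ((\<exists>C1. bilinear_bound (\<Union>k. D k) \<alpha> \<mu> \<nu> p p' C1) \<longrightarrow>
            (\<exists>C1 C2. best_constant (bilinear_bound (\<Union>k. D k) \<alpha> \<mu> \<nu> p p') C1 \<and>
                     best_constant (testing_bound (\<Union>k. D k) \<alpha> \<mu> \<nu> p p') C2 \<and>
                     C2 \<le> C1 \<and> C1 \<le> K * C2))"
proof (intro exI[of _ "4 * (carleson_const p p' + carleson_const p' p + 1)"] allI impI)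
  fix N :: nat and D :: "int \<Rightarrow> (nat \<Rightarrow> real) set set" and \<alpha> :: "(nat \<Rightarrow> real) set \<Rightarrow> real"
    and \<mu> \<nu> :: "(nat \<Rightarrow> real) measure"
  assume "dyadic_lattice N D" "\<forall>I\<in>(\<Union>k. D k). 0 \<le> \<alpha> I" "radon_measure N \<mu>" "radon_measure N \<nu>"
  then interpret laminar_pair "\<Union>k. D k" \<alpha> \<mu> \<nu> p p'
    using assms by (intro dyadic_laminar_pair)
  show "((\<exists>C1. bilinear_bound (\<Union>k. D k) \<alpha> \<mu> \<nu> p p' C1) \<longleftrightarrow>
            (\<exists>C2. testing_bound (\<Union>k. D k) \<alpha> \<mu> \<nu> p p' C2)) \<and>
           ((\<exists>C1. bilinear_bound (\<Union>k. D k) \<alpha> \<mu> \<nu> p p' C1) \<longrightarrow>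
            (\<exists>C1 C2. best_constant (bilinear_bound (\<Union>k. D k) \<alpha> \<mu> \<nu> p p') C1 \<and>
                     best_constant (testing_bound (\<Union>k. D k) \<alpha> \<mu> \<nu> p p') C2 \<and>
                     C2 \<le> C1 \<and> C1 \<le> 4 * (carleson_const p p' + carleson_const p' p + 1) * C2))"
    using bilinear_iff_testing best_constants by blast
qed

end
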